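(* Let $\mathbb{K}$ be a field of characteristic zero, let $R=\mathbb{K}[x_1,\ldots,x_n]$ and $\mathfrak{m}=\langle x_1,\ldots,x_n\rangle$. Let $J$ be any ideal in $R$ and let $M\subset R$ be an $\mathfrak{m}$-primary ideal. (i) The join of $J$ and $M$ equals $$J\star M=\{\,f\in R: A\bullet f\in J\ \text{ for all } A\in\mathfrak{A}(M)\,\}.$$ (ii) If $J$ is radical and $r\in\mathbb{N}$, then $$J^{(r)}=J\star\mathfrak{m}^r=\{\,f\in R:\partial_{\mathbf{x}}^\alpha\bullet f\in J\ \text{ for all }\alpha\in\mathbb{N}^n\text{ with }|\alpha|\le r-1\,\}.$$
   Context: Join: for ideals $J,K$ in $R$, $$J\star K:=\bigl(J(\mathbf{v})+K(\mathbf{w})+\langle x_i-v_i-w_i:1\le i\le n\rangle\bigr)\cap R,$$ where $J(\mathbf{v})$ is $J$ with new variables $v_i$ substituted for $x_i$, and $K(\mathbf{w})$ is $K$ with new variables $w_i$ substituted for $x_i$. The ideal in parentheses lives in $\mathbb{K}[x_1,\ldots,x_n,v_1,\ldots,v_n,w_1,\ldots,w_n]$. Equivalently, $J\star K$ is the kernel of the $\mathbb{K}$-algebra map $R\to R/J\otimes_{\mathbb{K}}R/K$, $x_i\mapsto\overline{x_i}\otimes1+1\otimes\overline{x_i}$. The space $\mathfrak{A}(M)$: for an $\mathfrak{m}$-primary ideal $M$, let $M^\perp=\{F\in\mathbb{K}[z_1,\ldots,z_n]: f(\partial_{z_1},\ldots,\partial_{z_n})\bullet F=0\text{ for all }f\in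 M\}$. Then $\mathfrak{A}(M)\subset\mathbb{K}[\partial_{x_1},\ldots,\partial_{x_n}]$ is the image of $M^\perp$ under the $\mathbb{K}$-linear map $\mathbf{z}^\alpha\mapsto\partial_{\mathbf{x}}^\alpha=\partial_{x_1}^{\alpha_1}\cdots\partial_{x_n}^{\alpha_n}$. It is a space of differential operators with constant coefficients. The symbol $\bullet$ denotes applying a differential operator to a polynomial, with $\partial_{x_i}\bullet f=\partial f/\partial x_i$, and $|\alpha|=\alpha_1+\cdots+\alpha_n$. Symbolic power: $J^{(r)}:=\bigcap_{\mathfrak{p}\in\mathrm{Ass}(J)}(J^rR_{\mathfrak{p}}\cap R)$, where $\mathrm{Ass}(J)$ is the set of associated primes of $R/J$. *)

theory Defs
  imports
    "HOL-Library.Poly_Mapping"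
    "HOL-Computational_Algebra.Fraction_Field"
    "HOL-Algebra.QuotRing"
    "HOL-Algebra.Ideal_Product"
    "HOL-Algebra.Algebraic_Closure_Type"
begin

section \<open>Ideals of a commutative ring given as a type\<close>

abbreviation type_ring :: "'a::comm_ring_1 ring" where
  "type_ring \<equiv> ring_of_type_algebra"

abbreviation is_ideal :: "'a::comm_ring_1 set \<Rightarrow> bool" where
  "is_ideal I \<equiv> ideal I type_ring"

text \<open>The power in the semiring of ideals: \<open>r\<close>-fold ideal product, with \<open>I\<close> to the \<open>0\<close> being
  the unit ideal.\<close>

definition ideal_power :: "'a::comm_ring_1 set \<Rightarrow> nat \<Rightarrow> 'a set" where
  "ideal_power I r = I [^]\<^bsub>ideals_set type_ring\<^esub> r"

definition ideal_radical :: "'a::comm_ring_1 set \<Rightarrow> 'a set" where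
  "ideal_radical I = {f. \<exists>k::nat. f ^ k \<in> I}"

definition primary_ideal :: "'a::comm_ring_1 set \<Rightarrow> bool" where
  "primary_ideal Q \<longleftrightarrow> is_ideal Q \<and> Q \<noteq> UNIV \<and>
     (\<forall>a b. a * b \<in> Q \<longrightarrow> a \<in> Q \<or> (\<exists>k::nat. b ^ k \<in> Q))"

definition is_primary_to :: "'a::comm_ring_1 set \<Rightarrow> 'a set \<Rightarrow> bool" where
  "is_primary_to Q p \<longleftrightarrow> primary_ideal Q \<and> ideal_radical Q = p"

text \<open>Associated primes of the module \<open>R/J\<close>: the prime ideals that are the annihilator of some
  element of \<open>R/J\<close>.\<close>

definition annihilator_Quot :: "'a::comm_ring_1 set \<Rightarrow> 'a set \<Rightarrow> 'a set" where
  "annihilator_Quot J m =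
     {a. (J +>\<^bsub>type_ring\<^esub> a) \<otimes>\<^bsub>type_ring Quot J\<^esub> m = \<zero>\<^bsub>type_ring Quot J\<^esub>}"

definition Ass :: "'a::comm_ring_1 set \<Rightarrow> 'a set set" where
  "Ass J = {p. primeideal p type_ring \<and>
               (\<exists>m\<in>carrier (type_ring Quot J). p = annihilator_Quot J m)}"

text \<open>The localization of a domain at a prime \<open>p\<close>, as a subring of the fraction field.\<close>

definition localization :: "'a::idom set \<Rightarrow> 'a fract ring" where
  "localization p = type_ring \<lparr>carrier := {Fraction_Field.Fract a s | a s. s \<notin> p}\<rparr>"

definition extended_ideal :: "'a::idom set \<Rightarrow> 'a set \<Rightarrow> 'a fract set" where
  "extended_ideal p I = Idl\<^bsub>localization p\<^esub> ((\<lambda>a. Fraction_Field.Fract a 1) ` I)"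

text \<open>For \<open>J = R\<close> there are no associated primes, and the empty intersection is \<open>R\<close>.\<close>

definition symbolic_power :: "'a::idom set \<Rightarrow> nat \<Rightarrow> 'a set" where
  "symbolic_power J r =
     (\<Inter>p\<in>Ass J. {f. Fraction_Field.Fract f 1 \<in> extended_ideal p (ideal_power J r)})"

section \<open>Polynomials\<close>

text \<open>Polynomials over \<open>'k\<close> in variables indexed by \<open>'n\<close>: finitely supported functions from
  exponent vectors to coefficients. For finite \<open>'n\<close> the number of variables is the cardinality
  of \<open>'n\<close>; a linear order on \<open>'n\<close> is the ordering of the variables, and it also provides the
  \<open>idom\<close> instance.\<close>

type_synonym ('n, 'k) mpoly = "('n \<Rightarrow>\<^sub>0 nat) \<Rightarrow>\<^sub>0 'k"

definition Var :: "'n \<Rightarrow> ('n, 'k::comm_ring_1) mpoly" where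
  "Var i = Poly_Mapping.single (Poly_Mapping.single i 1) 1"

definition Const :: "'k::comm_ring_1 \<Rightarrow> ('n, 'k) mpoly" where
  "Const c = Poly_Mapping.single 0 c"

definition subst :: "('n \<Rightarrow> ('m, 'k) mpoly) \<Rightarrow> ('n, 'k::comm_ring_1) mpoly \<Rightarrow> ('m, 'k) mpoly" where
  "subst h f = (\<Sum>m\<in>Poly_Mapping.keys f.
     Const (Poly_Mapping.lookup f m) *
     (\<Prod>i\<in>Poly_Mapping.keys m. h i ^ Poly_Mapping.lookup m i))"

definition max_ideal_0 :: "('n, 'k::comm_ring_1) mpoly set" where
  "max_ideal_0 = Idl\<^bsub>type_ring\<^esub> (range Var)"

section \<open>Join of ideals\<close>

text \<open>The variables of the ring in \<open>3n\<close> variables \<open>x\<^sub>i\<close>, \<open>v\<^sub>i\<close>, \<open>w\<^sub>i\<close>.\<close>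

datatype 'n join_var = Xvar 'n | Vvar 'n | Wvar 'n

definition join_ideal ::
  "('n, 'k::comm_ring_1) mpoly set \<Rightarrow> ('n, 'k) mpoly set \<Rightarrow> ('n join_var, 'k) mpoly set" where
  "join_ideal J K = Idl\<^bsub>type_ring\<^esub>
     (subst (\<lambda>i. Var (Vvar i)) ` J \<union> subst (\<lambda>i. Var (Wvar i)) ` K \<union>
      range (\<lambda>i. Var (Xvar i) - Var (Vvar i) - Var (Wvar i)))"

text \<open>The intersection with \<open>R\<close> is the preimage under the inclusion of \<open>R\<close> as the polynomials
  in the variables \<open>x\<^sub>i\<close>.\<close>

definition ideal_join ::
  "('n, 'k::comm_ring_1) mpoly set \<Rightarrow> ('n, 'k) mpoly set \<Rightarrow> ('n, 'k) mpoly set"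
  (infixl \<open>\<star>\<close> 70) where
  "J \<star> K = {f. subst (\<lambda>i. Var (Xvar i)) f \<in> join_ideal J K}"

section \<open>Differential operators with constant coefficients\<close>

definition partial_deriv :: "'n \<Rightarrow> ('n, 'k::comm_ring_1) mpoly \<Rightarrow> ('n, 'k) mpoly" where
  "partial_deriv i f = (\<Sum>m\<in>Poly_Mapping.keys f.
     Poly_Mapping.single (m - Poly_Mapping.single i 1)
       (of_nat (Poly_Mapping.lookup m i) * Poly_Mapping.lookup f m))"

text \<open>The composition of the \<open>\<alpha>\<^sub>i\<close>-th iterates of the \<open>i\<close>-th partial derivative, in
  the order of the variables.\<close>

definition partial_deriv_pow ::
  "('n::{finite,linorder} \<Rightarrow>\<^sub>0 nat) \<Rightarrow> ('n, 'k::comm_ring_1) mpoly \<Rightarrow> ('n, 'k) mpoly" where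
  "partial_deriv_pow \<alpha> f =
     foldr (\<lambda>i. partial_deriv i ^^ Poly_Mapping.lookup \<alpha> i) (sorted_list_of_set UNIV) f"

definition total_degree_exp :: "('n::finite \<Rightarrow>\<^sub>0 nat) \<Rightarrow> nat" where
  "total_degree_exp \<alpha> = (\<Sum>i\<in>UNIV. Poly_Mapping.lookup \<alpha> i)"

text \<open>\<open>diff_op F\<close> is the operator obtained from the polynomial \<open>F\<close> by replacing each monomial
  with exponent \<open>\<alpha>\<close> by \<open>partial_deriv_pow \<alpha>\<close>. Operators are functions on polynomials, so that
  the action on a polynomial is function application.\<close>

definition diff_op ::
  "('n::{finite,linorder}, 'k::comm_ring_1) mpoly \<Rightarrow> ('n, 'k) mpoly \<Rightarrow> ('n, 'k) mpoly" where
  "diff_op F = (\<lambda>f. \<Sum>\<alpha>\<in>Poly_Mapping.keys F.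
     Const (Poly_Mapping.lookup F \<alpha>) * partial_deriv_pow \<alpha> f)"

definition perp ::
  "('n::{finite,linorder}, 'k::comm_ring_1) mpoly set \<Rightarrow> ('n, 'k) mpoly set" where
  "perp M = {F. \<forall>f\<in>M. diff_op f F = 0}"

definition diff_space ::
  "('n::{finite,linorder}, 'k::comm_ring_1) mpoly set \<Rightarrow>
     (('n, 'k) mpoly \<Rightarrow> ('n, 'k) mpoly) set" (\<open>\<AA>\<close>) where
  "\<AA> M = diff_op ` perp M"

end

theory Submission
  imports Defs "HOL-Algebra.Ring_Divisibility"
begin

text \<open>
  Part (i) is duality. A linear functional on \<open>R/M\<close> vanishes on all but finitely many monomials, so
  it has the form \<open>f \<mapsto> (f(\<partial>)F)(0)\<close> for a polynomial \<open>F\<close>, and vanishing on the ideal \<open>M\<close> means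
  exactly \<open>F \<in> M\<^sup>\<bottom>\<close>. Modulo the relations \<open>x\<^sub>i - v\<^sub>i - w\<^sub>i\<close>, \<open>f \<in> J \<star> M\<close> says that
  \<open>f(v + w)\<close> vanishes in \<open>R/J \<otimes> R/M\<close>, that is, that applying any functional on \<open>R/M\<close> to the
  \<open>w\<close>-part sends \<open>f(v + w)\<close> into \<open>J\<close>. By Taylor's formula the functional given by \<open>F\<close> sends
  \<open>f(v + w)\<close> to \<open>F(\<partial>)f\<close>. The map obtained from \<open>F\<close> is \<open>join_pairing F\<close>, Taylor's formula is
  \<open>join_pairing_sum_vars\<close>, and the two inclusions are \<open>ideal_join_imp_diff_op_in\<close> and
  \<open>diff_op_in_imp_ideal_join\<close>. The argument works for
  every ideal that contains all but finitely many monomials. Among these is \<open>\<mm>\<^sup>r\<close>, whose inverse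
  system consists of the polynomials of degree less than \<open>r\<close>.

  Part (ii) then asserts that \<open>J\<^sup>(\<^sup>r\<^sup>)\<close> consists of the \<open>f\<close> all of whose derivatives of order less
  than \<open>r\<close> lie in \<open>J\<close>, the theorem of Zariski and Nagata. An element of \<open>J\<^sup>(\<^sup>r\<^sup>)\<close> is, up to a factor
  outside \<open>p\<close>, in \<open>J\<^sup>r\<close>, and each differentiation costs one power of \<open>J\<close>; hence its derivatives of
  order less than \<open>r\<close> lie in every associated prime \<open>p\<close>, and for radical \<open>J\<close> these intersect in \<open>J\<close>.
  The last fact needs enough associated primes and is the place where the Noetherian property enters.

  For the converse let \<open>p = (J : a)\<close> be an associated prime. As \<open>J\<close> is radical, \<open>a \<notin> p\<close>, so \<open>J\<close> and
  \<open>p\<close> agree locally at \<open>p\<close> and it suffices to treat a prime \<open>p\<close>. There the key is a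
  derivation \<open>E = \<Sum>\<^sub>i e\<^sub>i \<partial>\<^sub>i\<close> with all \<open>e\<^sub>i \<in> p\<close> that acts on \<open>p/p\<^sup>2\<close>, locally at \<open>p\<close>, as
  multiplication by some \<open>s \<notin> p\<close>, like the Euler field \<open>\<Sum>\<^sub>j y\<^sub>j \<partial>/\<partial>y\<^sub>j\<close> of local equations
  \<open>y\<^sub>j\<close> of the variety. By the Leibniz rule it acts on \<open>p\<^sup>m/p\<^sup>m\<^sup>+\<^sup>1\<close> as \<open>m s\<close>, which is invertible locally
  at \<open>p\<close> in characteristic zero. So if \<open>f \<in> p\<^sup>(\<^sup>m\<^sup>)\<close> and all \<open>\<partial>\<^sub>i f \<in> p\<^sup>(\<^sup>m\<^sup>)\<close>, then
  \<open>E f \<in> p\<^sup>(\<^sup>m\<^sup>+\<^sup>1\<^sup>)\<close> because of \<open>e\<^sub>i \<in> p\<close>, and therefore \<open>f \<in> p\<^sup>(\<^sup>m\<^sup>+\<^sup>1\<^sup>)\<close>; induction on \<open>m\<close> gives the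
  theorem (\<open>sym_power_if_partial_derivs_in_prime\<close>). The derivation is built by adjoining one variable
  at a time (\<open>euler_adjoin\<close>), which replaces the Jacobian criterion for smoothness at the generic
  point of a variety.
\<close>

abbreviation lookup :: "('a \<Rightarrow>\<^sub>0 'b::zero) \<Rightarrow> 'a \<Rightarrow> 'b" where
  "lookup \<equiv> Poly_Mapping.lookup"

abbreviation keys :: "('a \<Rightarrow>\<^sub>0 'b::zero) \<Rightarrow> 'a set" where
  "keys \<equiv> Poly_Mapping.keys"

abbreviation single :: "'a \<Rightarrow> 'b \<Rightarrow> ('a \<Rightarrow>\<^sub>0 'b::zero)" where
  "single \<equiv> Poly_Mapping.single"

(* Exponent vectors single i 1 are rewritten by the lemmas below; the simplifier would turn
   the exponent into Suc 0. *)
declare One_nat_def [simp del]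

section \<open>Induction over exponents and polynomials\<close>

lemma sum_single_lookup: "(\<Sum>m\<in>keys f. single m (lookup f m)) = f"
proof (rule poly_mapping_eqI)
  fix k
  have "lookup (\<Sum>m\<in>keys f. single m (lookup f m)) k = (\<Sum>m\<in>keys f. if m = k then lookup f m else 0)"
    by (simp add: lookup_sum lookup_single when_def)
  also have "\<dots> = lookup f k" by (simp add: in_keys_iff)
  finally show "lookup (\<Sum>m\<in>keys f. single m (lookup f m)) k = lookup f k" .
qed

lemma poly_mapping_add_induct [case_names single add]:
  fixes f :: "'a \<Rightarrow>\<^sub>0 'b::comm_monoid_add"
  assumes s: "\<And>m c. P (single m c)" and a: "\<And>f g. P f \<Longrightarrow> P g \<Longrightarrow> P (f + g)"
  shows "P f"
proof -
  have "P (\<Sum>m\<in>A. single m (lookup f m))" if "finite A" for A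
    using that
  proof (induction A rule: finite_induct)
    case empty
    then show ?case using s[of undefined 0] by simp
  next
    case (insert x F)
    then show ?case using a s by simp
  qed
  from this[OF finite_keys, of f] show ?thesis by (simp add: sum_single_lookup)
qed

lemma exponent_induct [case_names zero add_var]:
  fixes m :: "'a \<Rightarrow>\<^sub>0 nat"
  assumes z: "P 0" and s: "\<And>m i. P m \<Longrightarrow> P (m + single i 1)"
  shows "P m"
proof -
  have step: "P (m + single i k)" if "P m" for m i k
  proof (induction k)
    case (Suc k)
    have "m + single i (Suc k) = (m + single i k) + single i 1"
      by (simp add: add.assoc single_add[symmetric] Suc_eq_plus1)
    with s[OF Suc] show ?case by simp
  qed (use that in simp)
  have "P (\<Sum>i\<in>A. single i (lookup m i))" if "finite A" for A
    using that
  proof (induction A rule: finite_induct)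
    case (insert x F)
    then show ?case using step[of "\<Sum>i\<in>F. single i (lookup m i)" x "lookup m x"]
      by (simp add: add.commute)
  qed (use z in simp)
  from this[OF finite_keys, of m] show ?thesis by (simp add: sum_single_lookup)
qed

text \<open>Substitution, differentiation and the action of an operator are all defined by a sum over the
  support of a polynomial. Additivity of the summand in the coefficient makes such a map additive,
  so that it is determined by its values on monomials.\<close>

lemma additive_sum_keys:
  assumes "\<And>m. G m 0 = 0" and "\<And>m a b. G m (a + b) = G m a + G m b"
  shows "Modules.additive (\<lambda>f. \<Sum>m\<in>keys f. G m (lookup f m))"
  by (rule Modules.additive.intro, rule setsum_keys_plus_distrib) (use assms in auto)

lemma Const_mult_single: "Const c * single m d = single m (c * d)"
  by (simp add: Const_def mult_single)

lemma Const_mult: "Const (c * d) = Const c * Const d"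
  by (simp add: Const_def mult_single)

lemma Const_0 [simp]: "Const 0 = 0" by (simp add: Const_def)
lemma Const_1 [simp]: "Const 1 = 1" by (simp add: Const_def)
lemma Const_add: "Const (c + d) = Const c + Const d" by (simp add: Const_def single_add)

lemma Var_mult_single: "Var i * single m c = single (m + single i 1) c"
  by (simp add: Var_def mult_single add.commute)

lemma lookup_Const_mult: "lookup (Const c * f) m = c * lookup f m"
  by (induction f rule: poly_mapping_add_induct)
     (simp_all add: Const_mult_single lookup_single when_def lookup_add algebra_simps)

lemma mpoly_induct [case_names Const Var add mult]:
  fixes f :: "('n, 'k::comm_ring_1) mpoly"
  assumes "\<And>c. P (Const c)" "\<And>i. P (Var i)"
    and "\<And>f g. P f \<Longrightarrow> P g \<Longrightarrow> P (f + g)" "\<And>f g. P f \<Longrightarrow> P g \<Longrightarrow> P (f * g)"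
  shows "P f"
proof (induction f rule: poly_mapping_add_induct)
  case (single m c)
  show ?case
  proof (induction m rule: exponent_induct)
    case zero
    then show ?case using assms(1)[of c] by (simp add: Const_def)
  next
    case (add_var m i)
    then show ?case using assms(4)[OF assms(2)[of i] add_var] by (simp add: Var_mult_single)
  qed
qed (rule assms)

section \<open>Substitution is a homomorphism of algebras\<close>

lemma additive_subst: "Modules.additive (subst h)"
  unfolding subst_def
  by (rule additive_sum_keys) (simp_all add: Const_add distrib_right)

lemmas subst_add = additive.add[OF additive_subst]
  and subst_diff = additive.diff[OF additive_subst]
  and subst_0 = additive.zero[OF additive_subst]
  and subst_sum = additive.sum[OF additive_subst]

lemma subst_single:
  "subst h (single m c) = Const c * (\<Prod>i\<in>keys m. h i ^ lookup m i)"
  by (cases "c = 0") (simp_all add: subst_def)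

lemma subst_Const: "subst h (Const c) = Const c"
  by (simp add: Const_def subst_single[of _ 0, simplified])

lemma subst_Var: "subst h (Var i) = h i"
  by (simp add: Var_def subst_single)

lemma power_product_add:
  fixes h :: "'a \<Rightarrow> 'b::comm_monoid_mult"
  shows "(\<Prod>i\<in>keys (m + m'). h i ^ lookup (m + m') i) =
    (\<Prod>i\<in>keys m. h i ^ lookup m i) * (\<Prod>i\<in>keys m'. h i ^ lookup m' i)"
proof -
  have *: "(\<Prod>i\<in>keys n. h i ^ lookup n i) = (\<Prod>i\<in>keys m \<union> keys m'. h i ^ lookup n i)"
    if "keys n \<subseteq> keys m \<union> keys m'" for n :: "'a \<Rightarrow>\<^sub>0 nat"
    using that by (intro prod.mono_neutral_left) (auto simp: in_keys_iff)
  show ?thesis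
    unfolding *[OF Poly_Mapping.keys_add] *[of m, simplified] *[of m', simplified]
    by (simp add: lookup_add power_add prod.distrib)
qed

lemma subst_mult: "subst h (f * g) = subst h f * subst h g"
proof (induction f rule: poly_mapping_add_induct)
  case (single m c)
  show ?case
    by (induction g rule: poly_mapping_add_induct)
      (simp_all add: mult_single subst_single power_product_add Const_mult distrib_left distrib_right subst_add mult_ac)
qed (simp add: distrib_right subst_add)

lemma subst_subst: "subst h (subst g f) = subst (\<lambda>i. subst h (g i)) f"
  by (induction f rule: mpoly_induct) (simp_all add: subst_Const subst_Var subst_add subst_mult)

section \<open>Constant coefficient differential operators\<close>

lemma additive_partial_deriv: "Modules.additive (partial_deriv i)"
  unfolding partial_deriv_def
  by (rule additive_sum_keys) (simp_all add: single_add distrib_left)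

lemmas partial_deriv_add = additive.add[OF additive_partial_deriv]
  and partial_deriv_sum = additive.sum[OF additive_partial_deriv]

lemma partial_deriv_single:
  "partial_deriv i (single m c) = single (m - single i 1) (of_nat (lookup m i) * c)"
  by (cases "c = 0") (simp_all add: partial_deriv_def)

lemma exponent_diff_add: "lookup m i \<noteq> 0 \<Longrightarrow> m - single i 1 + n = m + n - single i (1::nat)"
  by (rule poly_mapping_eqI) (auto simp: lookup_add lookup_minus lookup_single when_def)

lemma partial_deriv_mult:
  "partial_deriv i (f * g) = f * partial_deriv i g + partial_deriv i f * g"
proof (induction f rule: poly_mapping_add_induct)
  case (single m c)
  show ?case
  proof (induction g rule: poly_mapping_add_induct)
    case (single n d)
    have "single (m - single i 1 + n) (of_nat (lookup m i) * c * d) =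
        single (m + n - single i 1) (of_nat (lookup m i) * c * d)"
      by (cases "lookup m i = 0") (simp_all add: exponent_diff_add)
    moreover have "single (m + (n - single i 1)) (of_nat (lookup n i) * c * d) =
        single (m + n - single i 1) (of_nat (lookup n i) * c * d)"
      using exponent_diff_add[of n i m] by (cases "lookup n i = 0") (simp_all add: add.commute)
    ultimately show ?case
      by (simp add: mult_single partial_deriv_single lookup_add algebra_simps single_add)
  qed (simp add: distrib_left distrib_right partial_deriv_add)
qed (simp add: distrib_left distrib_right partial_deriv_add)

lemma partial_deriv_Const [simp]: "partial_deriv i (Const c) = 0"
  by (simp add: Const_def partial_deriv_single)

lemma partial_deriv_Var: "partial_deriv i (Var j) = (if i = j then 1 else 0)"
  by (auto simp: Var_def partial_deriv_single lookup_single when_def)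

text \<open>The formula for coefficients, unlike the one for monomials, has no truncated subtraction of
  exponents, so that it is the convenient one for commuting derivatives.\<close>

lemma lookup_partial_deriv:
  "lookup (partial_deriv i f) m = of_nat (Suc (lookup m i)) * lookup f (m + single i 1)"
proof (induction f rule: poly_mapping_add_induct)
  case (single n c)
  show ?case
  proof (cases "lookup n i = 0")
    case True
    then have "n \<noteq> m + single i 1" by (auto simp: lookup_add)
    with True show ?thesis by (simp add: partial_deriv_single lookup_single)
  next
    case False
    then have "n - single i 1 = m \<longleftrightarrow> n = m + single i 1"
      using exponent_diff_add[of n i "single i 1"] by auto
    then show ?thesis by (auto simp: partial_deriv_single lookup_single when_def lookup_add add.commute)
  qed
qed (simp add: partial_deriv_add lookup_add algebra_simps)

lemma partial_deriv_commute: "partial_deriv i (partial_deriv j f) = partial_deriv j (partial_deriv i f)"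
  by (rule poly_mapping_eqI)
     (simp add: lookup_partial_deriv lookup_add lookup_single add_ac when_def algebra_simps)

text \<open>For commuting operators the position in the list at which the additional application of
  \<open>D j\<close> takes place is immaterial. With this, \<open>partial_deriv_pow\<close> has a recursion in which the order
  of the variables no longer occurs.\<close>

lemma foldr_commuting_step:
  assumes comm: "\<And>i j x. D i (D j x) = D j (D i x)" and "distinct xs" and "j \<in> set xs"
  shows "foldr (\<lambda>i. D i ^^ lookup (\<alpha> + single j 1) i) xs x = foldr (\<lambda>i. D i ^^ lookup \<alpha> i) xs (D j x)"
    (is "?l (\<alpha> + single j 1) xs x = _")
proof -
  have pow: "(D i ^^ k) (D j y) = D j ((D i ^^ k) y)" for i k y
    by (induction k) (simp_all add: comm)
  have fold: "?l \<alpha> ys (D j y) = D j (?l \<alpha> ys y)" for ys y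
    by (induction ys) (simp_all add: pow)
  have notin: "?l (\<alpha> + single j 1) ys y = ?l \<alpha> ys y" if "j \<notin> set ys" for ys y
    using that by (induction ys) (auto simp: lookup_add lookup_single when_def)
  show ?thesis using assms(2,3)
  proof (induction xs)
    case (Cons i xs)
    show ?case
    proof (cases "i = j")
      case True
      then show ?thesis using Cons.prems notin[of xs x]
        by (simp add: lookup_add fold pow Suc_eq_plus1[symmetric])
    next
      case False
      then show ?thesis using Cons by (simp add: lookup_add lookup_single)
    qed
  qed simp
qed

lemma partial_deriv_pow_0 [simp]: "partial_deriv_pow 0 f = f"
proof -
  have "foldr (\<lambda>i. partial_deriv i ^^ lookup 0 i) xs f = f" for xs
    by (induction xs) simp_all
  then show ?thesis by (simp add: partial_deriv_pow_def)
qed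

lemma partial_deriv_pow_step:
  "partial_deriv_pow (\<alpha> + single i 1) f = partial_deriv_pow \<alpha> (partial_deriv i f)"
  unfolding partial_deriv_pow_def
  by (rule foldr_commuting_step) (simp_all add: partial_deriv_commute)

lemma partial_deriv_pow_partial_deriv:
  "partial_deriv_pow \<alpha> (partial_deriv i f) = partial_deriv i (partial_deriv_pow \<alpha> f)"
proof (induction \<alpha> arbitrary: f rule: exponent_induct)
  case (add_var m j)
  then show ?case
    by (simp add: partial_deriv_pow_step partial_deriv_commute)
qed simp

lemma additive_partial_deriv_pow: "Modules.additive (partial_deriv_pow \<alpha>)"
proof
  show "partial_deriv_pow \<alpha> (f + g) = partial_deriv_pow \<alpha> f + partial_deriv_pow \<alpha> g"
    for f g :: "('a, 'b) mpoly"
    by (induction \<alpha> arbitrary: f g rule: exponent_induct)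
       (simp_all add: partial_deriv_pow_step partial_deriv_add)
qed

lemmas partial_deriv_pow_add = additive.add[OF additive_partial_deriv_pow]
  and partial_deriv_pow_zero = additive.zero[OF additive_partial_deriv_pow]

lemma partial_deriv_Const_mult: "partial_deriv i (Const c * f) = Const c * partial_deriv i f"
  by (simp add: partial_deriv_mult)

lemma partial_deriv_pow_Const_mult:
  "partial_deriv_pow \<alpha> (Const c * f) = Const c * partial_deriv_pow \<alpha> f"
  by (induction \<alpha> arbitrary: f rule: exponent_induct)
     (simp_all add: partial_deriv_pow_step partial_deriv_Const_mult)

text \<open>The commutator of \<open>\<partial>\<^sup>\<alpha>\<close> with multiplication by \<open>x\<^sub>i\<close> is the formal derivative of
  \<open>\<partial>\<^sup>\<alpha>\<close> by \<open>\<partial>\<^sub>i\<close>.\<close>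

lemma partial_deriv_pow_Var_mult:
  "partial_deriv_pow \<alpha> (Var i * f) =
     Var i * partial_deriv_pow \<alpha> f + of_nat (lookup \<alpha> i) * partial_deriv_pow (\<alpha> - single i 1) f"
proof (induction \<alpha> arbitrary: f rule: exponent_induct)
  case (add_var m j)
  have "partial_deriv_pow (m + single j 1) (Var i * f) =
      partial_deriv_pow m (Var i * partial_deriv j f + (if i = j then f else 0))"
    by (simp add: partial_deriv_pow_step partial_deriv_mult partial_deriv_Var)
  also have "\<dots> = Var i * partial_deriv_pow (m + single j 1) f +
      (of_nat (lookup m i) * partial_deriv_pow (m - single i 1 + single j 1) f
       + (if i = j then partial_deriv_pow m f else 0))"
    by (simp add: partial_deriv_pow_add add_var.IH partial_deriv_pow_step partial_deriv_pow_zero)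
  also have "of_nat (lookup m i) * partial_deriv_pow (m - single i 1 + single j 1) f =
      of_nat (lookup m i) * partial_deriv_pow (m + single j 1 - single i 1) f"
    by (cases "lookup m i = 0") (simp_all add: exponent_diff_add)
  finally show ?case by (auto simp: lookup_add lookup_single when_def algebra_simps)
qed simp

lemma partial_deriv_pow_Const: "partial_deriv_pow \<alpha> (Const c) = (if \<alpha> = 0 then Const c else 0)"
proof (induction \<alpha> rule: exponent_induct)
  case (add_var m i)
  have "m + single i 1 \<noteq> 0"
    by (metis add_is_0 lookup_add lookup_single_eq lookup_zero zero_neq_one)
  then show ?case by (simp add: partial_deriv_pow_step partial_deriv_pow_zero)
qed simp

lemma additive_diff_op: "Modules.additive (\<lambda>F. diff_op F f)"
  unfolding diff_op_def
  by (rule additive_sum_keys) (simp_all add: Const_add distrib_right)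

lemmas diff_op_add = additive.add[OF additive_diff_op]

lemma diff_op_single: "diff_op (single \<alpha> c) f = Const c * partial_deriv_pow \<alpha> f"
  by (cases "c = 0") (simp_all add: diff_op_def)

lemma additive_diff_op_arg: "Modules.additive (diff_op F)"
  by standard (simp add: diff_op_def partial_deriv_pow_add distrib_left sum.distrib)

lemmas diff_op_arg_add = additive.add[OF additive_diff_op_arg]

lemma diff_op_partial_deriv: "diff_op F (partial_deriv i f) = partial_deriv i (diff_op F f)"
  by (simp add: diff_op_def partial_deriv_sum partial_deriv_Const_mult partial_deriv_pow_partial_deriv)

lemma diff_op_Const: "diff_op (Const c) f = Const c * f"
  by (simp add: Const_def[of c] diff_op_single)

lemma diff_op_Var: "diff_op (Var i) f = partial_deriv i f"
  using partial_deriv_pow_step[of 0 i f] by (simp add: Var_def diff_op_single)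

lemma diff_op_Const_mult: "diff_op (Const c * F) f = Const c * diff_op F f"
  by (induction F rule: poly_mapping_add_induct)
     (simp_all add: Const_mult_single diff_op_single Const_mult distrib_left diff_op_add mult_ac)

lemma diff_op_Var_mult_left: "diff_op (Var i * F) f = diff_op F (partial_deriv i f)"
  by (induction F rule: poly_mapping_add_induct)
     (simp_all add: Var_mult_single diff_op_single partial_deriv_pow_step distrib_left diff_op_add)

lemma diff_op_mult: "diff_op (F * G) f = diff_op F (diff_op G f)"
  by (induction F arbitrary: G f rule: mpoly_induct)
     (simp_all add: diff_op_Const_mult diff_op_Const diff_op_Var_mult_left diff_op_partial_deriv
       diff_op_Var distrib_right diff_op_add mult.assoc)

text \<open>This is the recursion in \<open>f\<close> that \<open>F \<mapsto> F(\<partial>)f\<close> shares with the pairing of \<open>F\<close> with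
  \<open>f(v + w)\<close>: multiplication of \<open>f\<close> by \<open>x\<^sub>i = v\<^sub>i + w\<^sub>i\<close> becomes multiplication by \<open>x\<^sub>i\<close> plus
  differentiation of \<open>F\<close>.\<close>

lemma diff_op_Var_mult:
  "diff_op F (Var i * f) = Var i * diff_op F f + diff_op (partial_deriv i F) f"
proof (induction F rule: poly_mapping_add_induct)
  case (single m c)
  have "of_nat n * g = Const (of_nat n) * g" for n and g :: "('a, 'b) mpoly"
    by (simp add: Const_def)
  then show ?case
    by (simp add: diff_op_single partial_deriv_single partial_deriv_pow_Var_mult Const_mult)
       (simp add: algebra_simps)
qed (simp add: diff_op_add partial_deriv_add algebra_simps)

lemma diff_op_arg_Const: "diff_op F (Const c) = Const (c * lookup F 0)"
  by (induction F rule: poly_mapping_add_induct)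
     (auto simp: diff_op_single partial_deriv_pow_Const lookup_single when_def Const_mult mult.commute
        diff_op_add lookup_add distrib_left Const_add)

text \<open>The multi-index factorial \<open>\<alpha>!\<close>, the value of \<open>\<partial>\<^sup>\<alpha>\<close> on \<open>z\<^sup>\<alpha>\<close>.\<close>

definition exponent_fact :: "('n::finite \<Rightarrow>\<^sub>0 nat) \<Rightarrow> nat" where
  "exponent_fact \<alpha> = (\<Prod>i\<in>UNIV. fact (lookup \<alpha> i))"

lemma exponent_fact_0: "exponent_fact 0 = 1"
  by (simp add: exponent_fact_def)

lemma exponent_fact_nonzero: "exponent_fact \<alpha> \<noteq> 0"
  by (simp add: exponent_fact_def)

lemma exponent_fact_step: "exponent_fact (\<beta> + single i 1) = Suc (lookup \<beta> i) * exponent_fact \<beta>"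
proof -
  have "exponent_fact (\<beta> + single i 1) = fact (Suc (lookup \<beta> i)) * (\<Prod>j\<in>UNIV-{i}. fact (lookup \<beta> j))"
    unfolding exponent_fact_def
    by (subst prod.remove[of _ i]) (auto simp: lookup_add lookup_single when_def Suc_eq_plus1 intro!: prod.cong)
  also have "\<dots> = Suc (lookup \<beta> i) * exponent_fact \<beta>"
    by (simp add: exponent_fact_def prod.remove[of UNIV i "\<lambda>j. fact (lookup \<beta> j)"] algebra_simps)
  finally show ?thesis .
qed

text \<open>Clearing the denominator in \<open>\<partial>\<^sup>\<alpha> z\<^sup>\<alpha>\<^sup>+\<^sup>\<beta> = (\<alpha> + \<beta>)!/\<beta>! z\<^sup>\<beta>\<close> keeps the formula
  valid over every commutative ring.\<close>

lemma lookup_partial_deriv_pow: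
  "of_nat (exponent_fact \<beta>) * lookup (partial_deriv_pow \<alpha> F) \<beta> =
     of_nat (exponent_fact (\<alpha> + \<beta>)) * lookup F (\<alpha> + \<beta>)"
proof (induction \<alpha> arbitrary: \<beta> rule: exponent_induct)
  case (add_var m i)
  have "of_nat (exponent_fact \<beta>) * lookup (partial_deriv_pow (m + single i 1) F) \<beta> =
      of_nat (exponent_fact (\<beta> + single i 1)) * lookup (partial_deriv_pow m F) (\<beta> + single i 1)"
    by (simp add: partial_deriv_pow_step partial_deriv_pow_partial_deriv lookup_partial_deriv
        exponent_fact_step algebra_simps)
  also have "\<dots> = of_nat (exponent_fact (m + single i 1 + \<beta>)) * lookup F (m + single i 1 + \<beta>)"
    by (subst add_var.IH) (simp add: add_ac)
  finally show ?case .
qed simp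

lemma const_coeff_partial_deriv_pow:
  "lookup (partial_deriv_pow \<alpha> F) 0 = of_nat (exponent_fact \<alpha>) * lookup F \<alpha>"
  using lookup_partial_deriv_pow[of 0 \<alpha> F] by (simp add: exponent_fact_0)

section \<open>Ideals\<close>

interpretation mod_self: Modules.module "(*) :: 'a::comm_ring_1 \<Rightarrow> 'a \<Rightarrow> 'a"
  by standard (simp_all add: algebra_simps)

(* For the regular module this rule is associativity read from right to left; as a simp rule it
   loops with mult.assoc. *)
declare mod_self.scale_scale [simp del]

lemma type_ring_sel [simp]:
  "carrier type_ring = UNIV" "monoid.mult type_ring = (*)" "one type_ring = 1"
  "ring.zero type_ring = 0" "add type_ring = (+)"
  by (simp_all add: ring_of_type_algebra_def fun_eq_iff)

lemma is_ideal_iff: "is_ideal I \<longleftrightarrow> mod_self.subspace I"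
proof
  assume "is_ideal I"
  then interpret I: ideal I "type_ring" .
  show "mod_self.subspace I"
    using additive_subgroup.zero_closed[OF I.is_additive_subgroup]
      additive_subgroup.a_closed[OF I.is_additive_subgroup] I.I_l_closed
    by (intro mod_self.subspaceI) auto
next
  assume I: "mod_self.subspace I"
  show "is_ideal I"
  proof (rule idealI)
    show "ring (type_ring :: 'a ring)" by (rule ring_from_type_algebra)
    have neg: "inv\<^bsub>add_monoid type_ring\<^esub> x = - x" for x :: 'a
      using cring.axioms(1)[OF cring_from_type_algebra]
      by (intro group.inv_equality[OF abelian_group.a_group[OF ring.is_abelian_group]]) auto
    show "subgroup I (add_monoid type_ring)"
      by (rule subgroup.intro)
         (auto simp: neg[simplified] mod_self.subspace_add[OF I] mod_self.subspace_0[OF I] mod_self.subspace_neg[OF I])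
    show "x \<otimes>\<^bsub>type_ring\<^esub> a \<in> I" "a \<otimes>\<^bsub>type_ring\<^esub> x \<in> I" if "a \<in> I" for a x
      using mod_self.subspace_scale[OF I that, of x] by (simp_all add: mult.commute)
  qed
qed

lemmas ideal_0 = mod_self.subspace_0[folded is_ideal_iff]
  and ideal_add = mod_self.subspace_add[folded is_ideal_iff]
  and ideal_diff = mod_self.subspace_diff[folded is_ideal_iff]
  and ideal_sum = mod_self.subspace_sum[folded is_ideal_iff]
  and ideal_mult = mod_self.subspace_scale[folded is_ideal_iff]

lemma ideal_mult_right: "is_ideal I \<Longrightarrow> x \<in> I \<Longrightarrow> x * c \<in> I"
  using ideal_mult[of I x c] by (simp add: mult.commute)

lemma genideal_eq_span: "Idl\<^bsub>type_ring\<^esub> S = mod_self.span S"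
  unfolding genideal_def
  by (rule mod_self.span_unique[symmetric]) (auto simp: is_ideal_iff intro: mod_self.subspace_Inter[rule_format])

text \<open>A basis of \<open>M\<close> extends to a basis of the whole space, and the new basis vectors \<open>c\<close> form a basis
  of the quotient by \<open>M\<close>. The map \<open>\<phi> c\<close> is the coordinate functional of \<open>c\<close>; it is zero for all other
  vectors \<open>c\<close>.\<close>

lemma (in vector_space) coordinates_modulo_subspace:
  assumes "subspace M"
  obtains \<phi> :: "'b \<Rightarrow> 'b \<Rightarrow> 'a"
  where "\<And>c v w. \<phi> c (v + w) = \<phi> c v + \<phi> c w" "\<And>c k v. \<phi> c (scale k v) = k * \<phi> c v"
    and "\<And>c v. v \<in> M \<Longrightarrow> \<phi> c v = 0"
    and "\<And>v. finite {c. \<phi> c v \<noteq> 0}"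
    and "\<And>v. v - (\<Sum>c | \<phi> c v \<noteq> 0. scale (\<phi> c v) c) \<in> M"
proof -
  obtain B where B: "B \<subseteq> M" "independent B" "M \<subseteq> span B"
    using maximal_independent_subset[of M] by blast
  then have span: "span B = M" using assms by (metis span_subspace)
  define B' where "B' = extend_basis B"
  have B': "B \<subseteq> B'" "independent B'" "span B' = UNIV"
    using extend_basis_superset[OF B(2)] independent_extend_basis[OF B(2)] span_extend_basis[OF B(2)]
    by (simp_all add: B'_def)
  define \<phi> where "\<phi> c v = (if c \<in> B then 0 else representation B' v c)" for c v
  show ?thesis
  proof
    show "\<phi> c (v + w) = \<phi> c v + \<phi> c w" for c v w
      using B' by (simp add: \<phi>_def representation_add)
    show "\<phi> c (scale k v) = k * \<phi> c v" for c k v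
      using B' by (simp add: \<phi>_def representation_scale)
    show "\<phi> c v = 0" if "v \<in> M" for c v
      using representation_extend[OF B'(2) _ B'(1), of v] representation_ne_zero[of B v c] that
      by (auto simp: \<phi>_def span)
    show "finite {c. \<phi> c v \<noteq> 0}" for v
      by (rule finite_subset[OF _ finite_representation[of B' v]]) (auto simp: \<phi>_def)
    fix v
    have "v = (\<Sum>c | representation B' v c \<noteq> 0. scale (representation B' v c) c)"
      by (rule sum_nonzero_representation_eq[symmetric]) (use B' in auto)
    also have "\<dots> = (\<Sum>c | \<phi> c v \<noteq> 0. scale (\<phi> c v) c) +
        (\<Sum>c | c \<in> B \<and> representation B' v c \<noteq> 0. scale (representation B' v c) c)"
      (is "?s = ?t + ?u")
    proof -
      have split: "{c. representation B' v c \<noteq> 0} = {c. \<phi> c v \<noteq> 0} \<union> {c. c \<in> B \<and> representation B' v c \<noteq> 0}"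
        by (auto simp: \<phi>_def)
      have "finite {c. \<phi> c v \<noteq> 0}" "finite {c. c \<in> B \<and> representation B' v c \<noteq> 0}"
        by (rule finite_subset[OF _ finite_representation[of B' v]]; auto simp: \<phi>_def)+
      then show ?thesis
        unfolding split by (subst sum.union_disjoint) (auto simp: \<phi>_def intro!: arg_cong2[where f="(+)"] sum.cong)
    qed
    finally have "v - ?t = ?u"
      by (subst (asm) add.commute) (rule diff_eq_eq[THEN iffD2])
    also have "?u \<in> M"
      using B(1) by (intro subspace_sum[OF assms] subspace_scale[OF assms]) auto
    finally show "v - ?t \<in> M" .
  qed
qed

lemma vector_space_mpoly:
  "vector_space (\<lambda>c (f :: ('n, 'k::field) mpoly). Const c * f)"
  by (rule vector_space.intro) (simp_all only: Const_add Const_mult distrib_left distrib_right mult.assoc Const_1 mult_1_left)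

section \<open>The join with a zero-dimensional ideal\<close>

text \<open>The polynomial \<open>F\<close> defines the functional \<open>f \<mapsto> (f(\<partial>)F)(0)\<close>. The pairing applies it to the
  \<open>w\<close>-part of a polynomial in \<open>v\<close> and \<open>w\<close> and renames \<open>v\<^sub>i\<close> to \<open>x\<^sub>i\<close>: it sends
  \<open>v\<^sup>\<beta> w\<^sup>\<gamma>\<close> to \<open>(\<partial>\<^sup>\<gamma>F)(0) x\<^sup>\<beta>\<close>. The third group of variables is set to \<open>1\<close>;
  the pairing is meant for polynomials in which it does not occur.\<close>

definition join_pairing ::
  "('n::{finite,linorder}, 'k::comm_ring_1) mpoly \<Rightarrow> ('n join_var, 'k) mpoly \<Rightarrow> ('n, 'k) mpoly" where
  "join_pairing F p = (\<Sum>m\<in>keys p. single (Poly_Mapping.map_key Vvar m)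
     (lookup p m * lookup (partial_deriv_pow (Poly_Mapping.map_key Wvar m) F) 0))"

lemma additive_join_pairing: "Modules.additive (join_pairing F)"
  unfolding join_pairing_def
  by (rule additive_sum_keys) (simp_all add: single_add distrib_right)

lemmas join_pairing_add = additive.add[OF additive_join_pairing]
  and join_pairing_0 = additive.zero[OF additive_join_pairing]

lemma join_pairing_single:
  "join_pairing F (single m c) = single (Poly_Mapping.map_key Vvar m)
     (c * lookup (partial_deriv_pow (Poly_Mapping.map_key Wvar m) F) 0)"
  by (cases "c = 0") (simp_all add: join_pairing_def)

lemma inj_join_vars: "inj Vvar" "inj Wvar"
  by (simp_all add: inj_def)

lemma map_key_single_notin_range:
  assumes "inj f" "j \<notin> Set.range f"
  shows "Poly_Mapping.map_key f (single j k) = 0"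
  using assms by (intro poly_mapping_eqI) (auto simp: map_key.rep_eq lookup_single when_def)

lemma map_key_join_vars:
  "Poly_Mapping.map_key Vvar (m + m') = Poly_Mapping.map_key Vvar m + Poly_Mapping.map_key Vvar m'"
  "Poly_Mapping.map_key Wvar (m + m') = Poly_Mapping.map_key Wvar m + Poly_Mapping.map_key Wvar m'"
  "Poly_Mapping.map_key Vvar (single (Vvar i) k) = single i k"
  "Poly_Mapping.map_key Wvar (single (Wvar i) k) = single i k"
  "Poly_Mapping.map_key Vvar (single (Wvar i) k) = 0"
  "Poly_Mapping.map_key Wvar (single (Vvar i) k) = 0"
  "Poly_Mapping.map_key Vvar (single (Xvar i) k) = 0"
  "Poly_Mapping.map_key Wvar (single (Xvar i) k) = 0"
  by (simp_all add: map_key_plus map_key_single inj_join_vars map_key_single_notin_range image_iff)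

lemma join_pairing_Const: "join_pairing F (Const c) = Const (c * lookup F 0)"
  by (simp add: Const_def join_pairing_single inj_join_vars map_key_zero)

lemma join_pairing_Const_mult: "join_pairing F (Const c * p) = Const c * join_pairing F p"
  by (induction p rule: poly_mapping_add_induct)
     (simp_all only: Const_mult_single join_pairing_single join_pairing_add distrib_left mult.assoc)

lemma join_pairing_Vvar: "join_pairing F (Var (Vvar i) * p) = Var i * join_pairing F p"
  by (induction p rule: poly_mapping_add_induct)
     (simp_all add: Var_mult_single join_pairing_single join_pairing_add distrib_left map_key_join_vars)

lemma join_pairing_Wvar: "join_pairing F (Var (Wvar i) * p) = join_pairing (partial_deriv i F) p"
  by (induction p rule: poly_mapping_add_induct)
     (simp_all add: Var_mult_single join_pairing_single join_pairing_add distrib_left map_key_join_vars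
       partial_deriv_pow_step)

lemma additive_join_pairing_operator: "Modules.additive (\<lambda>F. join_pairing F p)"
  by standard (simp add: join_pairing_def partial_deriv_pow_add lookup_add distrib_left single_add sum.distrib)

lemma join_pairing_0_operator: "join_pairing 0 p = 0"
  by (rule additive.zero[OF additive_join_pairing_operator])

lemma join_pairing_Const_operator: "join_pairing (Const c * F) p = Const c * join_pairing F p"
  by (induction p rule: poly_mapping_add_induct)
     (simp_all only: Const_mult_single join_pairing_single join_pairing_add distrib_left
       partial_deriv_pow_Const_mult lookup_Const_mult mult.left_commute)

lemma join_pairing_subst_Vvar:
  "join_pairing F (subst (\<lambda>i. Var (Vvar i)) g * p) = g * join_pairing F p"
  by (induction g arbitrary: p rule: mpoly_induct)
     (simp_all only: subst_Const subst_Var subst_add subst_mult join_pairing_Const_mult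
       join_pairing_Vvar distrib_right join_pairing_add mult.assoc)

lemma join_pairing_subst_Wvar:
  "join_pairing F (subst (\<lambda>i. Var (Wvar i)) g * p) = join_pairing (diff_op g F) p"
proof (induction g arbitrary: p F rule: mpoly_induct)
  case (mult g h)
  have "diff_op (g * h) F = diff_op h (diff_op g F)"
    by (subst mult.commute) (rule diff_op_mult)
  then show ?case by (simp only: subst_mult mult.assoc mult.IH)
qed (simp_all only: subst_Const subst_Var subst_add join_pairing_Const_mult join_pairing_Wvar
     diff_op_Const join_pairing_Const_operator diff_op_Var distrib_right join_pairing_add
     diff_op_add additive.add[OF additive_join_pairing_operator])

text \<open>Taylor's formula in dual form. Both sides are linear in \<open>f\<close> and obey the same rule under
  multiplication of \<open>f\<close> by a variable, for all \<open>F\<close> at once. This avoids any expansion of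
  \<open>f(v + w)\<close> and any division by factorials.\<close>

lemma join_pairing_sum_vars:
  "join_pairing F (subst (\<lambda>i. Var (Vvar i) + Var (Wvar i)) f) = diff_op F f"
proof (induction f arbitrary: F rule: poly_mapping_add_induct)
  case (single m c)
  show ?case
  proof (induction m arbitrary: F rule: exponent_induct)
    case zero
    then show ?case
      by (simp add: Const_def[symmetric] subst_Const join_pairing_Const diff_op_arg_Const)
  next
    case (add_var m i)
    then show ?case
      by (simp add: Var_mult_single[symmetric] subst_mult subst_Var distrib_right join_pairing_add
          join_pairing_Vvar join_pairing_Wvar diff_op_Var_mult)
  qed
qed (simp add: subst_add join_pairing_add diff_op_arg_add)

lemma subst_1: "subst h 1 = 1"
  using subst_Const[of h 1] by simp

text \<open>The substitution \<open>x\<^sub>i \<mapsto> v\<^sub>i + w\<^sub>i\<close>, which kills the generators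
  \<open>x\<^sub>i - v\<^sub>i - w\<^sub>i\<close> of the join ideal.\<close>

definition eliminate_Xvar :: "'n join_var \<Rightarrow> ('n join_var, 'k::comm_ring_1) mpoly" where
  "eliminate_Xvar v = (case v of Xvar i \<Rightarrow> Var (Vvar i) + Var (Wvar i) | _ \<Rightarrow> Var v)"

text \<open>After elimination of the \<open>x\<^sub>i\<close>, the pairing with \<open>F \<in> M\<^sup>\<bottom>\<close> sends the join ideal into \<open>J\<close>: it is
  linear over \<open>R\<close> acting through \<open>v\<close>, which takes care of \<open>J(v)\<close>, and for \<open>g \<in> M\<close> multiplication by
  \<open>g(w)\<close> replaces \<open>F\<close> by \<open>g(\<partial>)F = 0\<close>.\<close>

lemma ideal_join_imp_diff_op_in:
  assumes J: "is_ideal J" and f: "f \<in> J \<star> M" and F: "F \<in> perp M"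
  shows "diff_op F f \<in> J"
proof -
  let ?\<sigma> = "subst eliminate_Xvar"
  have "join_pairing F (?\<sigma> q) \<in> J" if "q \<in> join_ideal J M" for q
    using that unfolding join_ideal_def genideal_eq_span
  proof (induction rule: mod_self.span_induct_alt)
    case base
    then show ?case using ideal_0[OF J] by (simp add: subst_0 join_pairing_0)
  next
    case (step c x y)
    have "join_pairing F (?\<sigma> x * ?\<sigma> c) \<in> J"
      using step(1)
    proof (elim UnE imageE rangeE)
      fix g assume "x = subst (\<lambda>i. Var (Vvar i)) g" "g \<in> J"
      then show ?thesis
        using ideal_mult_right[OF J] by (simp add: subst_subst subst_Var eliminate_Xvar_def join_pairing_subst_Vvar)
    next
      fix g assume "x = subst (\<lambda>i. Var (Wvar i)) g" "g \<in> M"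
      then show ?thesis using F ideal_0[OF J]
        by (simp add: subst_subst subst_Var eliminate_Xvar_def join_pairing_subst_Wvar perp_def
            join_pairing_0_operator)
    next
      fix i assume "x = Var (Xvar i) - Var (Vvar i) - Var (Wvar i)"
      then show ?thesis using ideal_0[OF J]
        by (simp add: subst_diff subst_Var eliminate_Xvar_def join_pairing_0)
    qed
    then show ?case
      using ideal_add[OF J _ step(2)] by (simp add: subst_add subst_mult join_pairing_add mult.commute)
  qed
  from this[of "subst (\<lambda>i. Var (Xvar i)) f"] f show ?thesis
    by (simp add: ideal_join_def subst_subst subst_Var eliminate_Xvar_def join_pairing_sum_vars)
qed

text \<open>Setting \<open>x\<^sub>i\<close> to \<open>1\<close> does not change a polynomial in \<open>v\<close> and \<open>w\<close>, and it turns every monomial into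
  the product of its \<open>v\<close>-part and its \<open>w\<close>-part.\<close>

lemma polynomial_in_sum_vars_expansion:
  fixes f :: "('n::{finite,linorder}, 'k::comm_ring_1) mpoly"
  defines "p \<equiv> subst (\<lambda>i. Var (Vvar i) + Var (Wvar i)) f"
  shows "p = (\<Sum>m\<in>keys p. Const (lookup p m) *
    subst (\<lambda>i. Var (Vvar i)) (single (Poly_Mapping.map_key Vvar m) 1) *
    subst (\<lambda>i. Var (Wvar i)) (single (Poly_Mapping.map_key Wvar m) 1))"
proof -
  define \<tau> :: "'n join_var \<Rightarrow> ('n join_var, 'k) mpoly" where
    "\<tau> v = (case v of Xvar _ \<Rightarrow> 1 | _ \<Rightarrow> Var v)" for v
  have single: "subst \<tau> (single m c) = Const c *
    subst (\<lambda>i. Var (Vvar i)) (single (Poly_Mapping.map_key Vvar m) 1) *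
    subst (\<lambda>i. Var (Wvar i)) (single (Poly_Mapping.map_key Wvar m) 1)" for m c
  proof (induction m rule: exponent_induct)
    case zero
    then show ?case
      by (simp add: inj_join_vars map_key_zero subst_single subst_1)
  next
    case (add_var m v)
    show ?case
      unfolding Var_mult_single[symmetric] subst_mult subst_Var add_var.IH map_key_join_vars
      by (cases v)
        (simp_all only: \<tau>_def join_var.case map_key_join_vars Var_mult_single[symmetric]
          subst_mult subst_Var mult.assoc mult.commute mult.left_commute add_0_right mult_1_left)
  qed
  have "subst \<tau> p = subst \<tau> (\<Sum>m\<in>keys p. single m (lookup p m))"
    by (simp only: sum_single_lookup)
  moreover have "subst \<tau> p = p"
    by (simp add: p_def subst_subst subst_add subst_Var \<tau>_def)
  ultimately show ?thesis by (simp add: subst_sum single)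
qed

lemma subst_diff_in_ideal:
  assumes "is_ideal I" and "\<And>i. h i - h' i \<in> I"
  shows "subst h f - subst h' f \<in> I"
proof (induction f rule: mpoly_induct)
  case (add f g)
  from ideal_add[OF assms(1) this] show ?case by (simp add: subst_add algebra_simps)
next
  case (mult f g)
  have "subst h (f * g) - subst h' (f * g) =
      subst h f * (subst h g - subst h' g) + subst h' g * (subst h f - subst h' f)"
    by (simp add: subst_mult algebra_simps)
  then show ?case using mult ideal_add[OF assms(1)] ideal_mult[OF assms(1)] by simp
qed (simp_all add: subst_Const subst_Var assms ideal_0)

text \<open>Write each \<open>w\<close>-monomial of \<open>f(v + w)\<close> modulo \<open>M(w)\<close> in a basis \<open>c\<close> of \<open>R/M\<close>. The coefficient of
  \<open>c(w)\<close> is then the image of \<open>f(v + w)\<close> under the coordinate functional of \<open>c\<close>. This functional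
  comes from some \<open>F\<^sub>c \<in> M\<^sup>\<bottom>\<close>, so the coefficient is \<open>F\<^sub>c(\<partial>)f \<in> J\<close>, substituted at \<open>v\<close>. Hence
  \<open>f(v + w) \<in> J(v) + M(w)\<close>.\<close>

lemma diff_op_in_imp_ideal_join:
  fixes J M :: "('n::{finite,linorder}, 'k::field_char_0) mpoly set"
  assumes J: "is_ideal J" and M: "is_ideal M" and fin: "finite {\<alpha>. single \<alpha> 1 \<notin> M}"
    and f: "\<And>F. F \<in> perp M \<Longrightarrow> diff_op F f \<in> J"
  shows "f \<in> J \<star> M"
proof -
  let ?V = "subst (\<lambda>i. Var (Vvar i))" and ?W = "subst (\<lambda>i. Var (Wvar i))"
  let ?I = "join_ideal J M"
  let ?mV = "Poly_Mapping.map_key Vvar" and ?mW = "Poly_Mapping.map_key Wvar"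
  interpret V: vector_space "\<lambda>c (f :: ('n, 'k) mpoly). Const c * f" by (rule vector_space_mpoly)
  have "V.subspace M"
    using ideal_0[OF M] ideal_add[OF M] ideal_mult[OF M] by (intro V.subspaceI) auto
  then obtain \<phi> :: "('n, 'k) mpoly \<Rightarrow> ('n, 'k) mpoly \<Rightarrow> 'k"
    where add: "\<And>c v w. \<phi> c (v + w) = \<phi> c v + \<phi> c w"
      and scale: "\<And>c k v. \<phi> c (Const k * v) = k * \<phi> c v"
      and van: "\<And>c v. v \<in> M \<Longrightarrow> \<phi> c v = 0"
      and fin\<phi>: "\<And>v. finite {c. \<phi> c v \<noteq> 0}"
      and repr: "\<And>v. v - (\<Sum>c | \<phi> c v \<noteq> 0. Const (\<phi> c v) * c) \<in> M"
    using V.coordinates_modulo_subspace by blast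
  have I: "is_ideal ?I" by (simp add: join_ideal_def genideal_eq_span is_ideal_iff)
  have gen: "x \<in> ?I" if "x \<in> ?V ` J \<union> ?W ` M \<union> range (\<lambda>i. Var (Xvar i) - Var (Vvar i) - Var (Wvar i))" for x
    unfolding join_ideal_def genideal_eq_span using that by (rule mod_self.span_base)
  (* The polynomial that represents the coordinate functional of c; the sum is finite because the
     functional vanishes on the monomials in M. *)
  define F where "F c = (\<Sum>\<alpha> | single \<alpha> 1 \<notin> M. single \<alpha> (\<phi> c (single \<alpha> 1) / of_nat (exponent_fact \<alpha>)))" for c
  have lookup_F: "of_nat (exponent_fact \<alpha>) * lookup (F c) \<alpha> = \<phi> c (single \<alpha> 1)" for c \<alpha>
  proof -
    have "lookup (F c) \<alpha> = (if single \<alpha> 1 \<notin> M then \<phi> c (single \<alpha> 1) / of_nat (exponent_fact \<alpha>) else 0)"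
      using fin by (simp add: F_def lookup_sum lookup_single when_def)
    then show ?thesis using exponent_fact_nonzero[of \<alpha>] van by simp
  qed
  have pairing: "lookup (diff_op g (F c)) 0 = \<phi> c g" for g c
  proof (induction g rule: poly_mapping_add_induct)
    case (single m a)
    have "\<phi> c (single m a) = a * \<phi> c (single m 1)"
      using scale[of c a "single m 1"] by (simp add: Const_mult_single)
    then show ?case
      by (simp add: diff_op_single lookup_Const_mult const_coeff_partial_deriv_pow lookup_F)
  qed (simp add: diff_op_add lookup_add add)
  have F: "F c \<in> perp M" for c
    unfolding perp_def
  proof (intro CollectI ballI poly_mapping_eqI)
    fix g \<beta> assume "g \<in> M"
    have "of_nat (exponent_fact \<beta>) * lookup (diff_op g (F c)) \<beta> = lookup (diff_op (single \<beta> 1 * g) (F c)) 0"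
      by (simp add: diff_op_mult diff_op_single const_coeff_partial_deriv_pow)
    also have "\<dots> = 0" using van ideal_mult[OF M \<open>g \<in> M\<close>] by (simp add: pairing)
    finally show "lookup (diff_op g (F c)) \<beta> = lookup 0 \<beta>" using exponent_fact_nonzero[of \<beta>] by simp
  qed
  define p where "p = subst (\<lambda>i. Var (Vvar i) + Var (Wvar i)) f"
  define C where "C = (\<Union>m\<in>keys p. {c. \<phi> c (single (?mW m) 1) \<noteq> 0})"
  have finC: "finite C" using fin\<phi> by (simp add: C_def)
  have pF: "join_pairing (F c) p = (\<Sum>m\<in>keys p. single (?mV m) (lookup p m * \<phi> c (single (?mW m) 1)))" for c
    by (simp add: join_pairing_def const_coeff_partial_deriv_pow lookup_F)
  have "p = (\<Sum>m\<in>keys p. Const (lookup p m) * ?V (single (?mV m) 1) * ?W (single (?mW m) 1))"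
    unfolding p_def by (rule polynomial_in_sum_vars_expansion)
  also have "\<dots> = (\<Sum>m\<in>keys p. Const (lookup p m) * ?V (single (?mV m) 1) *
        ?W (single (?mW m) 1 - (\<Sum>c\<in>C. Const (\<phi> c (single (?mW m) 1)) * c))) +
      (\<Sum>m\<in>keys p. \<Sum>c\<in>C. ?V (single (?mV m) (lookup p m * \<phi> c (single (?mW m) 1))) * ?W c)"
    (is "_ = ?s + ?t")
  proof -
    have "Const (lookup p m) * ?V (single (?mV m) 1) * ?W (single (?mW m) 1) =
        Const (lookup p m) * ?V (single (?mV m) 1) *
          ?W (single (?mW m) 1 - (\<Sum>c\<in>C. Const (\<phi> c (single (?mW m) 1)) * c)) +
        (\<Sum>c\<in>C. ?V (single (?mV m) (lookup p m * \<phi> c (single (?mW m) 1))) * ?W c)" for m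
    proof -
      let ?a = "?V (single (?mV m) 1)" and ?X = "single (?mW m) 1 :: ('n, 'k) mpoly"
      let ?S = "\<Sum>c\<in>C. Const (\<phi> c ?X) * c"
      have V: "?V (single (?mV m) (lookup p m * \<phi> c ?X)) = Const (lookup p m) * ?a * Const (\<phi> c ?X)" for c
      proof -
        have "single (?mV m) (lookup p m * \<phi> c ?X) = Const (lookup p m * \<phi> c ?X) * single (?mV m) 1"
          by (simp only: Const_mult_single mult_1_right)
        then show ?thesis by (simp only: subst_mult subst_Const Const_mult mult.commute mult.left_commute)
      qed
      have "?W ?S = (\<Sum>c\<in>C. Const (\<phi> c ?X) * ?W c)"
        by (simp only: subst_sum subst_mult subst_Const)
      then have "Const (lookup p m) * ?a * ?W ?S = (\<Sum>c\<in>C. ?V (single (?mV m) (lookup p m * \<phi> c ?X)) * ?W c)"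
        by (simp only: V sum_distrib_left mult.assoc)
      then show ?thesis
        by (simp only: subst_diff right_diff_distrib diff_add_cancel)
    qed
    then show ?thesis by (simp only: sum.distrib[symmetric])
  qed
  also have "?t = (\<Sum>c\<in>C. ?V (join_pairing (F c) p) * ?W c)"
    by (simp only: pF subst_sum sum_distrib_right) (rule sum.swap)
  finally have p: "p = ?s + (\<Sum>c\<in>C. ?V (join_pairing (F c) p) * ?W c)" .
  have s_in: "?s \<in> ?I"
  proof (rule ideal_sum[OF I], rule ideal_mult[OF I], rule gen)
    fix m assume "m \<in> keys p"
    then have "(\<Sum>c\<in>C. Const (\<phi> c (single (?mW m) 1)) * c) =
        (\<Sum>c | \<phi> c (single (?mW m) 1) \<noteq> 0. Const (\<phi> c (single (?mW m) 1)) * c)"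
      by (intro sum.mono_neutral_right finC) (auto simp: C_def)
    then have "single (?mW m) 1 - (\<Sum>c\<in>C. Const (\<phi> c (single (?mW m) 1)) * c) \<in> M"
      using repr[of "single (?mW m) 1"] by (simp only:)
    then show "?W (single (?mW m) 1 - (\<Sum>c\<in>C. Const (\<phi> c (single (?mW m) 1)) * c)) \<in>
        ?V ` J \<union> ?W ` M \<union> range (\<lambda>i. Var (Xvar i) - Var (Vvar i) - Var (Wvar i))"
      by blast
  qed
  have t_in: "?V (join_pairing (F c) p) * ?W c \<in> ?I" for c
  proof (rule ideal_mult_right[OF I], rule gen)
    have "join_pairing (F c) p \<in> J" using f[OF F] by (simp add: p_def join_pairing_sum_vars)
    then show "?V (join_pairing (F c) p) \<in>
        ?V ` J \<union> ?W ` M \<union> range (\<lambda>i. Var (Xvar i) - Var (Vvar i) - Var (Wvar i))"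
      by blast
  qed
  have "p \<in> ?I"
    by (subst p) (rule ideal_add[OF I s_in ideal_sum[OF I t_in]])
  moreover have "subst (\<lambda>i. Var (Xvar i)) f - p \<in> ?I"
    unfolding p_def
  proof (rule subst_diff_in_ideal[OF I])
    show "Var (Xvar i) - (Var (Vvar i) + Var (Wvar i)) \<in> ?I" for i
      unfolding diff_diff_eq[symmetric] by (rule gen) simp
  qed
  ultimately have "subst (\<lambda>i. Var (Xvar i)) f - p + p \<in> ?I"
    by (intro ideal_add[OF I])
  then show ?thesis by (simp only: ideal_join_def mem_Collect_eq diff_add_cancel)
qed

theorem ideal_join_eq:
  fixes J M :: "('n::{finite,linorder}, 'k::field_char_0) mpoly set"
  assumes "is_ideal J" "is_ideal M" "finite {\<alpha>. single \<alpha> 1 \<notin> M}"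
  shows "J \<star> M = {f. \<forall>A\<in>\<AA> M. A f \<in> J}"
  using ideal_join_imp_diff_op_in[OF assms(1)] diff_op_in_imp_ideal_join[OF assms]
  by (auto simp: diff_space_def)

section \<open>Powers of ideals\<close>

lemma ideal_power_0: "ideal_power I 0 = UNIV"
  by (simp add: ideal_power_def ideals_set_def)

lemma ideal_power_Suc: "ideal_power I (Suc r) = ideal_prod type_ring (ideal_power I r) I"
  by (simp add: ideal_power_def ideals_set_def)

lemma is_ideal_UNIV: "is_ideal UNIV"
  by (simp add: is_ideal_iff)

lemma is_ideal_power: "is_ideal I \<Longrightarrow> is_ideal (ideal_power I r)"
  by (induction r)
     (simp_all add: ideal_power_0 is_ideal_UNIV ideal_power_Suc
        ring.ideal_prod_is_ideal[OF ring_from_type_algebra])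

lemma ideal_power_mult_Suc: "f \<in> ideal_power I r \<Longrightarrow> g \<in> I \<Longrightarrow> f * g \<in> ideal_power I (Suc r)"
  using ideal_prod.prod[of f "ideal_power I r" g I type_ring] by (simp add: ideal_power_Suc)

lemma ideal_power_Suc_induct [consumes 1, case_names prod add]:
  assumes "f \<in> ideal_power I (Suc r)"
    and "\<And>g h. g \<in> ideal_power I r \<Longrightarrow> h \<in> I \<Longrightarrow> P (g * h)"
    and "\<And>g h. P g \<Longrightarrow> P h \<Longrightarrow> P (g + h)"
  shows "P f"
  using assms(1) unfolding ideal_power_Suc
  by (induction f rule: ideal_prod.induct) (use assms(2,3) in auto)

lemma total_degree_exp_add: "total_degree_exp (\<alpha> + \<beta>) = total_degree_exp \<alpha> + total_degree_exp \<beta>"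
  by (simp add: total_degree_exp_def lookup_add sum.distrib)

lemma total_degree_exp_single: "total_degree_exp (single i k) = k"
  by (simp add: total_degree_exp_def lookup_single when_def)

text \<open>Polynomials with all terms of degree at least \<open>r\<close> form an ideal, and degrees add up in
  products.\<close>

lemma max_ideal_power_keys:
  fixes f :: "('n::finite, 'k::comm_ring_1) mpoly"
  assumes "f \<in> ideal_power max_ideal_0 r" "m \<in> keys f"
  shows "r \<le> total_degree_exp m"
proof -
  define T :: "nat \<Rightarrow> ('n, 'k) mpoly set" where "T r = {f. \<forall>m\<in>keys f. r \<le> total_degree_exp m}" for r
  have T_add: "f + g \<in> T r" if "f \<in> T r" "g \<in> T r" for f g r
    using that Poly_Mapping.keys_add[of f g] unfolding T_def by blast
  have T_mult: "f * g \<in> T (r + s)" if "f \<in> T r" "g \<in> T s" for f g r s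
    using that Poly_Mapping.keys_mult[of f g] unfolding T_def
    by (fastforce simp: total_degree_exp_add intro: add_mono)
  have "mod_self.subspace (T 1)"
  proof (rule mod_self.subspaceI)
    show "c * x \<in> T 1" if "x \<in> T 1" for c x
      using T_mult[of c 0 x 1] that by (simp add: T_def)
    show "0 \<in> T 1" by (simp add: T_def)
  qed (rule T_add)
  moreover have "range Var \<subseteq> T 1"
    by (auto simp: T_def Var_def total_degree_exp_single split: if_splits)
  ultimately have max: "max_ideal_0 \<subseteq> T 1"
    unfolding max_ideal_0_def genideal_eq_span by (rule mod_self.span_minimal[rotated])
  have "f \<in> T r" using assms(1)
  proof (induction r arbitrary: f)
    case (Suc r)
    from Suc.prems show ?case
      by (induction rule: ideal_power_Suc_induct)
         (use Suc.IH max T_mult[of _ r _ 1] T_add in \<open>auto simp: Suc_eq_plus1\<close>)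
  qed (simp add: T_def)
  then show ?thesis using assms(2) by (simp add: T_def)
qed

lemma is_ideal_max_ideal: "is_ideal max_ideal_0"
  by (simp add: is_ideal_iff max_ideal_0_def genideal_eq_span)

lemma Var_in_max_ideal: "Var i \<in> max_ideal_0"
  by (simp add: max_ideal_0_def genideal_eq_span mod_self.span_base)

lemma single_in_max_ideal_power:
  fixes m :: "'n::finite \<Rightarrow>\<^sub>0 nat"
  shows "r \<le> total_degree_exp m \<Longrightarrow> single m c \<in> ideal_power max_ideal_0 r"
proof (induction r arbitrary: m)
  case (Suc r)
  then have "total_degree_exp m \<noteq> 0" by simp
  then obtain i where "lookup m i \<noteq> 0"
    unfolding total_degree_exp_def by (auto simp: sum_eq_0_iff)
  then have m: "m - single i 1 + single i 1 = m"
    using exponent_diff_add[of m i "single i 1"] by simp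
  then have "r \<le> total_degree_exp (m - single i 1)"
    using Suc.prems total_degree_exp_add[of "m - single i 1" "single i 1"]
    by (simp add: total_degree_exp_single)
  from ideal_power_mult_Suc[OF Suc.IH[OF this] Var_in_max_ideal, of i]
  show ?case by (simp add: mult.commute[of _ "Var i"] Var_mult_single m)
qed (simp add: ideal_power_0)

lemma finite_bounded_exponents: "finite {\<alpha> :: 'n::finite \<Rightarrow>\<^sub>0 nat. \<forall>i. lookup \<alpha> i < k}"
proof (rule finite_imageD)
  have "lookup ` {\<alpha> :: 'n \<Rightarrow>\<^sub>0 nat. \<forall>i. lookup \<alpha> i < k} \<subseteq> PiE UNIV (\<lambda>_. {..<k})"
    by (auto simp: PiE_def extensional_def)
  then show "finite (lookup ` {\<alpha> :: 'n \<Rightarrow>\<^sub>0 nat. \<forall>i. lookup \<alpha> i < k})"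
    by (rule finite_subset) (simp add: finite_PiE)
qed (simp add: inj_on_def)

text \<open>Since \<open>M\<close> has radical \<open>\<mm>\<close>, it contains a power of each variable, hence every monomial in which
  some exponent is large.\<close>

lemma finite_monomials_outside_primary:
  fixes M :: "('n::finite, 'k::comm_ring_1) mpoly set"
  assumes "is_primary_to M max_ideal_0"
  shows "finite {\<alpha>. single \<alpha> 1 \<notin> M}"
proof -
  have M: "is_ideal M" and rad: "ideal_radical M = max_ideal_0"
    using assms by (simp_all add: is_primary_to_def primary_ideal_def)
  have "\<exists>k. Var i ^ k \<in> M" for i
  proof -
    have "Var i \<in> ideal_radical M" unfolding rad by (rule Var_in_max_ideal)
    then show ?thesis by (simp add: ideal_radical_def)
  qed
  then obtain k where k: "\<And>i. Var i ^ k i \<in> M" by metis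
  have Var_pow: "Var i ^ k = single (single i k) 1" for i k
    by (induction k) (simp_all add: Var_mult_single single_add[symmetric], simp add: Suc_eq_plus1)
  have "single \<alpha> 1 \<in> M" if "k i \<le> lookup \<alpha> i" for \<alpha> i
  proof -
    have "single i (k i) + (\<alpha> - single i (k i)) = \<alpha>"
      using that by (intro poly_mapping_eqI) (auto simp: lookup_add lookup_minus lookup_single when_def)
    then have "(single \<alpha> 1 :: ('n, 'k) mpoly) = Var i ^ k i * single (\<alpha> - single i (k i)) 1"
      by (simp add: Var_pow mult_single)
    then show ?thesis using ideal_mult_right[OF M k] by simp
  qed
  moreover have "k i \<le> (\<Sum>i\<in>UNIV. k i)" for i
    by (rule member_le_sum) auto
  ultimately have "{\<alpha>. single \<alpha> 1 \<notin> M} \<subseteq> {\<alpha>. \<forall>i. lookup \<alpha> i < (\<Sum>i\<in>UNIV. k i)}"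
    by (smt (verit) Collect_mono_iff le_trans linorder_not_less)
  then show ?thesis by (rule finite_subset[OF _ finite_bounded_exponents])
qed

lemma finite_monomials_outside_max_ideal_power:
  "finite {\<alpha> :: 'n::finite \<Rightarrow>\<^sub>0 nat. single \<alpha> (1::'k::comm_ring_1) \<notin> ideal_power max_ideal_0 r}"
proof (rule finite_subset[OF _ finite_bounded_exponents])
  have "lookup \<alpha> i \<le> total_degree_exp \<alpha>" for \<alpha> :: "'n \<Rightarrow>\<^sub>0 nat" and i
    unfolding total_degree_exp_def by (rule member_le_sum) auto
  then show "{\<alpha> :: 'n \<Rightarrow>\<^sub>0 nat. single \<alpha> (1::'k) \<notin> ideal_power max_ideal_0 r} \<subseteq> {\<alpha>. \<forall>i. lookup \<alpha> i < r}"
    using single_in_max_ideal_power[of r] by (smt (verit) Collect_mono_iff le_trans linorder_not_less)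
qed

lemma partial_deriv_pow_single_eq_0:
  fixes c :: "'k::field_char_0"
  assumes "\<And>\<beta>. \<alpha> \<noteq> \<gamma> + \<beta>"
  shows "partial_deriv_pow \<gamma> (single \<alpha> c) = 0"
proof (rule poly_mapping_eqI)
  fix \<beta>
  have "of_nat (exponent_fact \<beta>) * lookup (partial_deriv_pow \<gamma> (single \<alpha> c)) \<beta> = 0"
    using assms by (simp add: lookup_partial_deriv_pow lookup_single)
  then show "lookup (partial_deriv_pow \<gamma> (single \<alpha> c)) \<beta> = lookup 0 \<beta>"
    using exponent_fact_nonzero[of \<beta>] by simp
qed

text \<open>The inverse system of \<open>\<mm>\<^sup>r\<close> is spanned by the monomials \<open>z\<^sup>\<alpha>\<close> with \<open>|\<alpha>| < r\<close>: such
  monomials are killed by every operator of order at least \<open>r\<close>, and a monomial \<open>z\<^sup>\<gamma>\<close> of degree at least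
  \<open>r\<close> occurring in \<open>F\<close> would survive as the constant term of \<open>\<partial>\<^sup>\<gamma>F\<close>.\<close>

theorem ideal_join_max_ideal_power:
  fixes J :: "('n::{finite,linorder}, 'k::field_char_0) mpoly set"
  assumes J: "is_ideal J"
  shows "J \<star> ideal_power max_ideal_0 r = {f. \<forall>\<alpha>. total_degree_exp \<alpha> < r \<longrightarrow> partial_deriv_pow \<alpha> f \<in> J}"
proof -
  let ?P = "perp (ideal_power max_ideal_0 r) :: ('n, 'k) mpoly set"
  have deg: "total_degree_exp \<gamma> < r" if F: "F \<in> ?P" and "\<gamma> \<in> keys F" for F \<gamma>
  proof (rule ccontr)
    assume "\<not> total_degree_exp \<gamma> < r"
    then have "(single \<gamma> 1 :: ('n, 'k) mpoly) \<in> ideal_power max_ideal_0 r"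
      by (intro single_in_max_ideal_power) simp
    then have "diff_op (single \<gamma> 1) F = 0" using F by (simp add: perp_def)
    then have "of_nat (exponent_fact \<gamma>) * lookup F \<gamma> = 0"
      by (simp add: diff_op_single const_coeff_partial_deriv_pow[symmetric])
    with that(2) exponent_fact_nonzero[of \<gamma>] show False by (simp add: in_keys_iff)
  qed
  have low: "single \<alpha> 1 \<in> ?P" if "total_degree_exp \<alpha> < r" for \<alpha> :: "'n \<Rightarrow>\<^sub>0 nat"
    unfolding perp_def
  proof (intro CollectI ballI)
    fix g :: "('n, 'k) mpoly" assume g: "g \<in> ideal_power max_ideal_0 r"
    have "partial_deriv_pow \<gamma> (single \<alpha> (1::'k)) = 0" if "\<gamma> \<in> keys g" for \<gamma>
      using max_ideal_power_keys[OF g that] \<open>total_degree_exp \<alpha> < r\<close>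
      by (intro partial_deriv_pow_single_eq_0) (auto simp: total_degree_exp_add)
    then show "diff_op g (single \<alpha> 1) = 0" by (simp add: diff_op_def)
  qed
  have "(\<forall>F\<in>?P. diff_op F f \<in> J) \<longleftrightarrow> (\<forall>\<alpha>. total_degree_exp \<alpha> < r \<longrightarrow> partial_deriv_pow \<alpha> f \<in> J)" for f
  proof (intro iffI allI impI ballI)
    fix \<alpha> :: "'n \<Rightarrow>\<^sub>0 nat" assume "\<forall>F\<in>?P. diff_op F f \<in> J" "total_degree_exp \<alpha> < r"
    then show "partial_deriv_pow \<alpha> f \<in> J"
      using low[of \<alpha>] by (force simp: diff_op_single)
  next
    fix F assume "\<forall>\<alpha>. total_degree_exp \<alpha> < r \<longrightarrow> partial_deriv_pow \<alpha> f \<in> J" "F \<in> ?P"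
    then show "diff_op F f \<in> J"
      unfolding diff_op_def using deg by (intro ideal_sum[OF J] ideal_mult[OF J]) blast
  qed
  then show ?thesis
    by (subst ideal_join_eq[OF J is_ideal_power[OF is_ideal_max_ideal] finite_monomials_outside_max_ideal_power])
       (simp add: diff_space_def)
qed

section \<open>Powers of a prime ideal and Euler derivations\<close>

lemma ideal_power_mult:
  assumes I: "is_ideal I" and f: "f \<in> ideal_power I r"
  shows "g \<in> ideal_power I s \<Longrightarrow> f * g \<in> ideal_power I (r + s)"
proof (induction s arbitrary: g)
  case 0
  show ?case using ideal_mult_right[OF is_ideal_power[OF I] f, of g] by (simp only: add_0_right)
next
  case (Suc s)
  from Suc.prems show ?case
  proof (induction rule: ideal_power_Suc_induct)
    case (prod g h)
    from ideal_power_mult_Suc[OF Suc.IH[OF prod(1)] prod(2)]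
    show ?case by (simp only: mult.assoc add_Suc_right)
  next
    case (add g h)
    from ideal_add[OF is_ideal_power[OF I] this]
    show ?case by (simp only: distrib_left)
  qed
qed
definition derivation :: "('a::comm_ring_1 \<Rightarrow> 'a) \<Rightarrow> bool" where
  "derivation D \<longleftrightarrow> (\<forall>f g. D (f + g) = D f + D g) \<and> (\<forall>f g. D (f * g) = f * D g + D f * g)"

lemma derivation_add: "derivation D \<Longrightarrow> D (f + g) = D f + D g"
  and derivation_mult: "derivation D \<Longrightarrow> D (f * g) = f * D g + D f * g"
  by (simp_all add: derivation_def)

lemma derivation_0: "derivation D \<Longrightarrow> D 0 = 0"
  using derivation_add[of D 0 0] by simp

lemma derivation_diff: "derivation D \<Longrightarrow> D (f - g) = D f - D g"
  using derivation_add[of D "f - g" g] by simp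

lemma derivation_combination:
  "derivation D \<Longrightarrow> derivation D' \<Longrightarrow> derivation (\<lambda>f. a * D f + b * D' f)"
  by (simp add: derivation_def algebra_simps)

lemma derivation_poly_killing_coeffs:
  fixes G :: "'a::idom poly"
  assumes D: "derivation D" and "\<And>i. D (coeff G i) = 0"
  shows "D (poly G y) = poly (pderiv G) y * D y"
  using assms(2)
proof (induction G)
  case (pCons c G)
  from pCons.prems[of "Suc i" for i] have "D (poly G y) = poly (pderiv G) y * D y"
    by (intro pCons.IH) simp
  then show ?case using pCons.prems[of 0]
    by (simp add: derivation_add[OF D] derivation_mult[OF D] pderiv_pCons algebra_simps)
qed (simp add: derivation_0[OF D])

text \<open>The condition on the image of the natural numbers says that the residue field at \<open>p\<close> has characteristic
  zero.\<close>

locale prime_residue_char_0 =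
  fixes p :: "'a::{idom,ring_char_0} set"
  assumes ideal: "is_ideal p" and one: "1 \<notin> p"
    and prime: "a * b \<in> p \<Longrightarrow> a \<in> p \<or> b \<in> p"
    and of_nat: "0 < m \<Longrightarrow> of_nat m \<notin> p"
begin

text \<open>The symbolic power \<open>p\<^sup>(\<^sup>r\<^sup>)\<close> of the prime \<open>p\<close>, that is, the contraction of \<open>p\<^sup>r R\<^sub>p\<close>. Working
  with multipliers outside \<open>p\<close> instead of fractions keeps all computations in the ring.\<close>

definition sym_power :: "nat \<Rightarrow> 'a set" where
  "sym_power r = {f. \<exists>s. s \<notin> p \<and> s * f \<in> ideal_power p r}"

lemma ideal_power_subset: "ideal_power p r \<subseteq> sym_power r"
  unfolding sym_power_def using one by (auto intro!: exI[of _ 1])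

lemma notin_mult: "a \<notin> p \<Longrightarrow> b \<notin> p \<Longrightarrow> a * b \<notin> p"
  using prime by blast

lemma sym_power_cancel:
  assumes "t \<notin> p" "t * f \<in> sym_power r"
  shows "f \<in> sym_power r"
proof -
  obtain s where "s \<notin> p" "s * (t * f) \<in> ideal_power p r"
    using assms(2) unfolding sym_power_def by blast
  then have "s * t \<notin> p" "s * t * f \<in> ideal_power p r"
    using notin_mult[OF _ assms(1)] by (simp_all only: mult.assoc not_False_eq_True)
  then show ?thesis unfolding sym_power_def by blast
qed

lemma sym_power_add:
  assumes "f \<in> sym_power r" "g \<in> sym_power r"
  shows "f + g \<in> sym_power r"
proof -
  obtain s t where s: "s \<notin> p" "s * f \<in> ideal_power p r" and t: "t \<notin> p" "t * g \<in> ideal_power p r"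
    using assms unfolding sym_power_def by blast
  note I = is_ideal_power[OF ideal, of r]
  have "s * t * (f + g) = t * (s * f) + s * (t * g)" by (simp add: algebra_simps)
  also have "\<dots> \<in> ideal_power p r" using ideal_add[OF I] ideal_mult[OF I] s t by blast
  finally show ?thesis using notin_mult[OF s(1) t(1)] unfolding sym_power_def by blast
qed

lemma sym_power_mult:
  assumes "f \<in> sym_power r" "g \<in> sym_power r'"
  shows "f * g \<in> sym_power (r + r')"
proof -
  obtain s t where s: "s \<notin> p" "s * f \<in> ideal_power p r" and t: "t \<notin> p" "t * g \<in> ideal_power p r'"
    using assms unfolding sym_power_def by blast
  have "s * t * (f * g) = (s * f) * (t * g)" by (simp add: algebra_simps)
  also have "\<dots> \<in> ideal_power p (r + r')" by (rule ideal_power_mult[OF ideal s(2) t(2)])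
  finally show ?thesis using notin_mult[OF s(1) t(1)] unfolding sym_power_def by blast
qed

lemma sym_power_0: "f \<in> sym_power 0"
  using ideal_power_subset[of 0] by (auto simp: ideal_power_0)

lemma sym_power_scale: "f \<in> sym_power r \<Longrightarrow> c * f \<in> sym_power r"
  using sym_power_mult[OF sym_power_0, of f r c] by simp

lemma is_ideal_sym_power: "is_ideal (sym_power r)"
  unfolding is_ideal_iff
  using ideal_0[OF is_ideal_power[OF ideal]] ideal_power_subset
  by (intro mod_self.subspaceI sym_power_add sym_power_scale) auto

lemmas sym_power_diff = ideal_diff[OF is_ideal_sym_power]
lemmas sym_power_sum = ideal_sum[OF is_ideal_sym_power]

lemma prime_subset_sym_power: "f \<in> p \<Longrightarrow> f \<in> sym_power 1"
  using ideal_power_mult_Suc[of 1 p 0 f] ideal_power_subset[of 1] by (auto simp: ideal_power_0 Suc_eq_plus1)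

lemma sym_power_mult_prime:
  "f \<in> sym_power r \<Longrightarrow> g \<in> p \<Longrightarrow> f * g \<in> sym_power (r + 1)"
  by (intro sym_power_mult prime_subset_sym_power)

lemma prime_mult_prime: "f \<in> p \<Longrightarrow> g \<in> p \<Longrightarrow> f * g \<in> sym_power 2"
  using sym_power_mult_prime[OF prime_subset_sym_power, of f g] by (simp only: one_add_one)

text \<open>If \<open>p\<close> is locally generated by coordinates \<open>y\<^sub>j\<close>, the model is the Euler field
  \<open>\<Sum>\<^sub>j y\<^sub>j \<partial>/\<partial>y\<^sub>j\<close>, which is the identity on \<open>p/p\<^sup>2\<close>. The factor \<open>s\<close> is a common denominator. The
  set \<open>A\<close> restricts the condition to the part of \<open>p\<close> for which it has been established so far.\<close>

definition euler_derivation :: "('a \<Rightarrow> 'a) \<Rightarrow> 'a \<Rightarrow> 'a set \<Rightarrow> bool" where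
  "euler_derivation E s A \<longleftrightarrow> derivation E \<and> range E \<subseteq> p \<and> s \<notin> p \<and> (\<forall>h\<in>A \<inter> p. E h - s * h \<in> sym_power 2)"

text \<open>On a product of \<open>m\<close> elements of \<open>p\<close> the Leibniz rule yields \<open>m\<close> terms, each contributing a
  factor \<open>s\<close>; a further factor from the ring is differentiated into \<open>p\<close>.\<close>

lemma euler_on_ideal_power:
  assumes "euler_derivation E s UNIV" and "f \<in> ideal_power p m"
  shows "E f - of_nat m * s * f \<in> sym_power (m + 1)"
  using assms(2)
proof (induction m arbitrary: f)
  case 0
  then show ?case using assms(1) by (auto simp: euler_derivation_def intro!: prime_subset_sym_power)
next
  case (Suc m)
  from assms(1) have E: "derivation E" and E2: "\<And>h. h \<in> p \<Longrightarrow> E h - s * h \<in> sym_power 2"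
    by (auto simp: euler_derivation_def)
  from Suc.prems show ?case
  proof (induction rule: ideal_power_Suc_induct)
    case (prod g h)
    have "g * (E h - s * h) \<in> sym_power (m + 2)"
      using prod ideal_power_subset by (intro sym_power_mult E2) auto
    moreover have "(E g - of_nat m * s * g) * h \<in> sym_power (m + 1 + 1)"
      using prod by (intro sym_power_mult_prime Suc.IH)
    moreover have "m + 2 = Suc m + 1" "m + 1 + 1 = Suc m + 1" by simp_all
    ultimately have "g * (E h - s * h) + (E g - of_nat m * s * g) * h \<in> sym_power (Suc m + 1)"
      by (metis sym_power_add)
    also have "g * (E h - s * h) + (E g - of_nat m * s * g) * h = E (g * h) - of_nat (Suc m) * s * (g * h)"
      by (simp add: derivation_mult[OF E] algebra_simps)
    finally show ?case .
  next
    case (add g h)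
    from sym_power_add[OF this] show ?case
      by (simp add: derivation_add[OF E] algebra_simps)
  qed
qed

lemma euler_on_sym_power:
  assumes "euler_derivation E s UNIV" and "f \<in> sym_power m"
  shows "E f - of_nat m * s * f \<in> sym_power (m + 1)"
proof -
  obtain t where t: "t \<notin> p" "t * f \<in> ideal_power p m"
    using assms(2) unfolding sym_power_def by blast
  from assms(1) have E: "derivation E" and "E t \<in> p" by (auto simp: euler_derivation_def)
  have "E (t * f) - of_nat m * s * (t * f) - f * E t \<in> sym_power (m + 1)"
    by (intro sym_power_diff euler_on_ideal_power[OF assms(1)] sym_power_mult_prime t assms \<open>E t \<in> p\<close>)
  also have "E (t * f) - of_nat m * s * (t * f) - f * E t = t * (E f - of_nat m * s * f)"
    by (simp add: derivation_mult[OF E] algebra_simps)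
  finally show ?thesis using t(1) by (rule sym_power_cancel[rotated])
qed

text \<open>The derivation acts on the quotient of consecutive symbolic powers as the scalar \<open>m s\<close>, which is
  outside \<open>p\<close> and can be cancelled. Here characteristic zero is essential: in characteristic \<open>m\<close> the scalar
  would be zero.\<close>

lemma sym_power_Suc_if_euler_derivation:
  assumes "euler_derivation E s UNIV" and "0 < m" and "f \<in> sym_power m" and "E f \<in> sym_power (m + 1)"
  shows "f \<in> sym_power (m + 1)"
proof (rule sym_power_cancel)
  show "of_nat m * s \<notin> p"
    using assms(1,2) by (intro notin_mult of_nat) (auto simp: euler_derivation_def)
  have "E f - (E f - of_nat m * s * f) \<in> sym_power (m + 1)"
    by (intro sym_power_diff assms euler_on_sym_power)
  then show "of_nat m * s * f \<in> sym_power (m + 1)" by simp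
qed

text \<open>The terms in which \<open>y\<close> is differentiated are products of a coefficient in \<open>p\<close> and an element of
  \<open>p\<close>, so they vanish modulo the second symbolic power.\<close>

lemma euler_poly_coeffs_in_prime:
  assumes E: "derivation E" "range E \<subseteq> p" and "\<And>i. coeff P i \<in> p"
    and "\<And>i. E (coeff P i) - s * coeff P i \<in> sym_power 2"
  shows "E (poly P y) - s * poly P y \<in> sym_power 2 \<and> poly P y \<in> p"
  using assms(3,4)
proof (induction P)
  case 0
  then show ?case using derivation_0[OF E(1)] ideal_0[OF is_ideal_sym_power] ideal_0[OF ideal] by simp
next
  case (pCons c P)
  have IH: "E (poly P y) - s * poly P y \<in> sym_power 2" "poly P y \<in> p"
    using pCons.IH pCons.prems[of "Suc i" for i] by simp_all
  have c: "c \<in> p" "E c - s * c \<in> sym_power 2" using pCons.prems[of 0] by simp_all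
  have "E c - s * c + y * (E (poly P y) - s * poly P y) + poly P y * E y \<in> sym_power 2"
    using IH c E(2) by (intro sym_power_add sym_power_scale prime_mult_prime) auto
  also have "E c - s * c + y * (E (poly P y) - s * poly P y) + poly P y * E y =
      E (poly (pCons c P) y) - s * poly (pCons c P) y"
    by (simp add: derivation_add[OF E(1)] derivation_mult[OF E(1)] algebra_simps)
  finally show ?case using c(1) IH(2) by (simp add: ideal_add[OF ideal] ideal_mult[OF ideal])
qed

definition polys_over :: "'a set \<Rightarrow> 'a poly set" where
  "polys_over A = {P. \<forall>i. coeff P i \<in> A}"

text \<open>The step from \<open>A\<close> to \<open>A[y]\<close>. Either \<open>y\<close> is transcendental over \<open>A\<close> modulo \<open>p\<close>, so that every
  polynomial over \<open>A\<close> whose value at \<open>y\<close> lies in \<open>p\<close> has its coefficients in \<open>p\<close>; then \<open>E\<close> itself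
  works. Or there is an algebraic relation modulo \<open>p\<close>. Take one of least degree and let \<open>g \<in> p\<close> be its
  value at \<open>y\<close>. By minimality \<open>u = \<delta> g\<close> is outside \<open>p\<close> (separability in characteristic zero), and
  \<open>u E + (s g - E g) \<delta>\<close> takes the value \<open>s u g\<close> at \<open>g\<close>, while on \<open>A\<close> it is \<open>u E\<close>. Pseudo-division by
  the relation extends the property to \<open>A[y]\<close>.\<close>

lemma euler_adjoin:
  assumes A: "0 \<in> A" "1 \<in> A" "\<And>a b. a \<in> A \<Longrightarrow> b \<in> A \<Longrightarrow> a - b \<in> A" "\<And>a b. a \<in> A \<Longrightarrow> b \<in> A \<Longrightarrow> a * b \<in> A"
    and E: "euler_derivation E s A"
    and \<delta>: "derivation \<delta>" "\<And>a. a \<in> A \<Longrightarrow> \<delta> a = 0" "\<delta> y = 1"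
  obtains u a s' where "a \<in> p" "euler_derivation (\<lambda>f. u * E f + a * \<delta> f) s' ((\<lambda>P. poly P y) ` polys_over A)"
proof -
  define relation where "relation P \<longleftrightarrow> P \<in> polys_over A \<and> poly P y \<in> p \<and> (\<exists>i. coeff P i \<notin> p)" for P
  have dE: "derivation E" "range E \<subseteq> p" "s \<notin> p" "\<And>h. h \<in> A \<Longrightarrow> h \<in> p \<Longrightarrow> E h - s * h \<in> sym_power 2"
    using E by (auto simp: euler_derivation_def)
  show thesis
  proof (cases "\<exists>P. relation P")
    case False
    have "euler_derivation (\<lambda>f. 1 * E f + 0 * \<delta> f) s ((\<lambda>P. poly P y) ` polys_over A)"
      unfolding euler_derivation_def
    proof (intro conjI ballI)
      fix h assume "h \<in> (\<lambda>P. poly P y) ` polys_over A \<inter> p"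
      then obtain P where P: "P \<in> polys_over A" "h = poly P y" "poly P y \<in> p" by auto
      with False have "\<And>i. coeff P i \<in> p" by (auto simp: relation_def)
      then show "1 * E h + 0 * \<delta> h - s * h \<in> sym_power 2"
        using euler_poly_coeffs_in_prime[OF dE(1,2), of P s y] dE(4) P(1)
        by (simp add: P(2) polys_over_def)
    qed (use dE in simp_all)
    then show thesis using ideal_0[OF ideal] that by blast
  next
    case True
    define G where "G = arg_min degree relation"
    have G: "relation G" and G_min: "\<And>P. relation P \<Longrightarrow> degree G \<le> degree P"
      using True arg_min_natI arg_min_nat_le unfolding G_def by metis+
    define l d where "l = lead_coeff G" and "d = degree G"
    have coeff_G: "coeff G i \<in> A" for i using G by (simp add: relation_def polys_over_def)
    define g where "g = poly G y"
    have g: "g \<in> p" using G by (simp add: relation_def g_def)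
    have l: "l \<notin> p"
    proof
      assume "l \<in> p"
      define G' where "G' = G - monom l d"
      obtain i where i: "coeff G i \<notin> p" using G by (auto simp: relation_def)
      with \<open>l \<in> p\<close> have "i \<noteq> d" by (auto simp: l_def d_def)
      with i have "coeff G' i \<notin> p" by (simp add: G'_def)
      moreover have "G' \<in> polys_over A"
        using coeff_G A by (auto simp: polys_over_def G'_def l_def)
      moreover have "poly G' y \<in> p"
        using g ideal_diff[OF ideal] ideal_mult_right[OF ideal \<open>l \<in> p\<close>] by (simp add: G'_def poly_monom g_def)
      ultimately have "relation G'" by (auto simp: relation_def)
      moreover have "degree G' < d"
      proof -
        have "G' = 0 \<or> degree G' < d"
          by (rule eq_zero_or_degree_less)
            (auto simp: G'_def l_def d_def intro!: degree_diff_le degree_monom_le)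
        then show ?thesis using \<open>coeff G' i \<notin> p\<close> ideal_0[OF ideal] by auto
      qed
      ultimately show False using G_min[of G'] by (simp add: d_def)
    qed
    have d: "0 < d"
    proof (rule ccontr)
      assume "\<not> 0 < d"
      then obtain c where "G = [:c:]" by (auto simp: d_def elim: degree_eq_zeroE)
      then show False using g l by (simp add: g_def l_def)
    qed
    define u where "u = \<delta> g"
    have u: "u \<notin> p"
    proof
      assume "u \<in> p"
      have "u = poly (pderiv G) y"
        using derivation_poly_killing_coeffs[OF \<delta>(1), of G y] \<delta>(2,3) coeff_G by (simp add: u_def g_def)
      moreover have "coeff (pderiv G) i \<in> A" for i
      proof -
        have plus: "a + b \<in> A" if "a \<in> A" "b \<in> A" for a b
          using A(3)[OF that(1) A(3)[OF A(1) that(2)]] by simp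
        have "of_nat n \<in> A" for n by (induction n) (use A plus in auto)
        then show ?thesis using A(4) coeff_G by (simp add: coeff_pderiv del: of_nat_Suc)
      qed
      moreover have "coeff (pderiv G) (d - 1) \<notin> p"
        using notin_mult[OF of_nat[OF d] l] d by (simp add: coeff_pderiv l_def d_def del: of_nat_Suc)
      ultimately have "relation (pderiv G)" using \<open>u \<in> p\<close> by (auto simp: relation_def polys_over_def)
      from G_min[OF this] show False using d by (simp add: degree_pderiv d_def)
    qed
    define a where "a = s * g - E g"
    have a: "a \<in> p"
      unfolding a_def using g dE(2) by (intro ideal_diff[OF ideal] ideal_mult[OF ideal]) auto
    define E' where "E' f = u * E f + a * \<delta> f" for f
    define s' where "s' = s * u"
    have E': "derivation E'" unfolding E'_def[abs_def] by (rule derivation_combination) fact+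
    have E'p: "E' f \<in> p" for f
      unfolding E'_def using dE(2) a
      by (intro ideal_add[OF ideal] ideal_mult[OF ideal] ideal_mult_right[OF ideal]) auto
    have E'g: "E' g = s' * g"
      by (simp add: E'_def a_def s'_def u_def[symmetric] algebra_simps)
    have E'A: "E' h - s' * h \<in> sym_power 2" if "h \<in> A" "h \<in> p" for h
      using sym_power_scale[OF dE(4)[OF that], of u] \<delta>(2)[OF that(1)]
      by (simp add: E'_def s'_def algebra_simps)
    (* Pseudo-division by G, one leading term at a time. *)
    have main: "E' (poly P y) - s' * poly P y \<in> sym_power 2"
      if "P \<in> polys_over A" "poly P y \<in> p" for P
      using that
    proof (induction "degree P" arbitrary: P rule: less_induct)
      case less
      note P = less.prems
      show ?case
      proof (cases "degree P < d")
        case True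
        then have "\<And>i. coeff P i \<in> p" using G_min[of P] P by (force simp: relation_def d_def)
        then show ?thesis
          using euler_poly_coeffs_in_prime[OF E', of P s' y] E'p E'A P(1) by (auto simp: polys_over_def)
      next
        case False
        define n c where "n = degree P" and "c = lead_coeff P"
        define P' where "P' = smult l P - monom c (n - d) * G"
        define h b where "h = poly P y" and "b = c * y ^ (n - d)"
        have cP: "coeff P i \<in> A" for i using P by (simp add: polys_over_def)
        have "coeff P' i \<in> A" for i
          unfolding P'_def coeff_diff coeff_smult coeff_monom_mult
          using cP coeff_G A by (auto simp: l_def c_def)
        then have "P' \<in> polys_over A" by (simp add: polys_over_def)
        moreover have P'y: "poly P' y = l * h - b * g"
          by (simp add: P'_def poly_monom h_def b_def g_def)
        then have "poly P' y \<in> p"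
          using P(2) g by (simp add: h_def ideal_diff[OF ideal] ideal_mult[OF ideal])
        moreover have "degree P' < degree P"
        proof -
          have "degree (monom c (n - d) * G) \<le> n"
            using degree_mult_le[of "monom c (n - d)" G] degree_monom_le[of c "n - d"] False
            by (simp add: n_def d_def)
          then have "degree P' \<le> n"
            unfolding P'_def by (intro degree_diff_le) (simp_all add: n_def degree_smult_le)
          moreover have "coeff P' n = 0"
            using False by (simp add: P'_def coeff_monom_mult l_def c_def n_def d_def)
          ultimately have "P' = 0 \<or> degree P' < n" by (rule eq_zero_or_degree_less)
          then show ?thesis using False d by (auto simp: n_def)
        qed
        ultimately have IH: "E' (l * h - b * g) - s' * (l * h - b * g) \<in> sym_power 2"
          unfolding P'y[symmetric] by (intro less.hyps)
        have hp: "h \<in> p" using P by (simp add: h_def)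
        (* The defects caused by the multipliers l and b are products of two elements of p. *)
        have "E' (l * h - b * g) - s' * (l * h - b * g) - h * E' l + g * E' b \<in> sym_power 2"
          by (rule sym_power_add[OF sym_power_diff[OF IH prime_mult_prime[OF hp E'p]] prime_mult_prime[OF g E'p]])
        also have "E' (l * h - b * g) - s' * (l * h - b * g) - h * E' l + g * E' b = l * (E' h - s' * h)"
          by (simp add: derivation_diff[OF E'] derivation_mult[OF E'] E'g algebra_simps)
        finally show ?thesis using sym_power_cancel[OF l] by (simp add: h_def)
      qed
    qed
    have "euler_derivation E' s' ((\<lambda>P. poly P y) ` polys_over A)"
      unfolding euler_derivation_def using E' E'p main notin_mult[OF dE(3) u] by (auto simp: s'_def)
    then show thesis using a that unfolding E'_def[abs_def] by blast
  qed
qed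

end

lemma derivation_partial_deriv: "derivation (partial_deriv i)"
  by (simp add: derivation_def partial_deriv_add partial_deriv_mult)

text \<open>Nonzero constants are units, so the residue fields of a polynomial ring over a field of
  characteristic zero have characteristic zero.\<close>

locale mpoly_prime =
  fixes p :: "('n::{finite,linorder}, 'k::field_char_0) mpoly set"
  assumes ideal_p: "is_ideal p" and one_notin_p: "1 \<notin> p"
    and prime_p: "a * b \<in> p \<Longrightarrow> a \<in> p \<or> b \<in> p"
begin

lemma Const_in_p: "Const c \<in> p \<Longrightarrow> c = 0"
  using ideal_mult[OF ideal_p, of "Const c" "Const (1 / c)"] one_notin_p
  by (cases "c = 0") (simp_all add: Const_mult[symmetric])

sublocale prime_residue_char_0 p
proof (rule prime_residue_char_0.intro)
  show "of_nat m \<notin> p" if "0 < m" for m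
    using Const_in_p[of "of_nat m"] that by (auto simp: Const_def)
qed (fact ideal_p one_notin_p prime_p)+

text \<open>Starting from the constants, which meet \<open>p\<close> only in zero, the variables are adjoined one at a time. The
  subrings \<open>A\<close> are generated by the variables treated so far, and the derivative with respect to any other
  variable vanishes on them.\<close>

lemma euler_derivation_exists: "\<exists>e s. (\<forall>i. e i \<in> p) \<and> euler_derivation (\<lambda>f. \<Sum>i\<in>UNIV. e i * partial_deriv i f) s UNIV"
proof -
  let ?E = "\<lambda>e f. \<Sum>i\<in>UNIV. e i * partial_deriv i f"
  define Q where "Q V A e s \<longleftrightarrow>
      range Const \<subseteq> A \<and> Var ` V \<subseteq> A \<and> (\<forall>a\<in>A. \<forall>b\<in>A. a - b \<in> A \<and> a * b \<in> A) \<and>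
      (\<forall>i. \<forall>a\<in>A. i \<notin> V \<longrightarrow> partial_deriv i a = 0) \<and> (\<forall>i. e i \<in> p) \<and> euler_derivation (?E e) s A"
    for V A e s
  have "\<exists>A e s. Q V A e s" if "finite V" for V :: "'n set"
    using that
  proof (induction V rule: finite_induct)
    case empty
    have "(Const a :: ('n, 'k) mpoly) - Const b \<in> range Const" for a b :: 'k
      by (rule range_eqI[of _ _ "a - b"]) (simp add: Const_def single_diff)
    then have ring: "\<forall>a\<in>range Const :: ('n, 'k) mpoly set. \<forall>b\<in>range Const. a - b \<in> range Const \<and> a * b \<in> range Const"
      by (auto simp: Const_mult[symmetric])
    have "euler_derivation (?E (\<lambda>_. 0)) 1 (range Const)"
      unfolding euler_derivation_def using one_notin_p ideal_0[OF ideal_p] ideal_0[OF is_ideal_sym_power]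
      by (auto simp: derivation_def dest: Const_in_p)
    with ring have "Q {} (range Const) (\<lambda>_. 0) 1"
      unfolding Q_def using ideal_0[OF ideal_p] by (simp add: image_subset_iff)
    then show ?case by blast
  next
    case (insert y V)
    then obtain A e s where "Q V A e s" by blast
    then have A: "range Const \<subseteq> A" "Var ` V \<subseteq> A"
      "\<And>a b. a \<in> A \<Longrightarrow> b \<in> A \<Longrightarrow> a - b \<in> A" "\<And>a b. a \<in> A \<Longrightarrow> b \<in> A \<Longrightarrow> a * b \<in> A"
      "\<And>i a. a \<in> A \<Longrightarrow> i \<notin> V \<Longrightarrow> partial_deriv i a = 0"
      and e: "\<And>i. e i \<in> p" and E: "euler_derivation (?E e) s A"
      unfolding Q_def by simp_all
    have A01: "0 \<in> A" "1 \<in> A" using A(1) Const_0 Const_1 by (metis rangeI subsetD)+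
    have plus: "a + b \<in> A" if "a \<in> A" "b \<in> A" for a b
      using A(3)[OF that(1) A(3)[OF A01(1) that(2)]] by simp
    obtain u a s' where a: "a \<in> p" and
      E': "euler_derivation (\<lambda>f. u * ?E e f + a * partial_deriv y f) s' ((\<lambda>P. poly P (Var y)) ` polys_over A)"
      by (rule euler_adjoin[OF A01 A(3,4) E derivation_partial_deriv, of y "Var y"])
        (use A(5) insert(2) in \<open>auto simp: partial_deriv_Var\<close>)
    let ?A = "(\<lambda>P. poly P (Var y)) ` polys_over A"
    define e' where "e' i = u * e i + (if i = y then a else 0)" for i
    have "?E e' f = u * ?E e f + a * partial_deriv y f" for f
    proof -
      have "e' i * partial_deriv i f =
          u * (e i * partial_deriv i f) + (if i = y then a * partial_deriv i f else 0)" for i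
        by (simp add: e'_def algebra_simps)
      then show ?thesis by (simp add: sum.distrib sum_distrib_left)
    qed
    then have E'': "euler_derivation (?E e') s' ?A" using E' by simp
    have e'p: "e' i \<in> p" for i
      using e a ideal_mult[OF ideal_p] ideal_add[OF ideal_p] by (simp add: e'_def)
    have sub: "A \<subseteq> ?A"
    proof
      fix x assume "x \<in> A"
      then have "[:x:] \<in> polys_over A" using A01(1) by (simp add: polys_over_def coeff_pCons split: nat.split)
      then show "x \<in> ?A" by (intro image_eqI[of _ _ "[:x:]"]) simp_all
    qed
    have "[:0, 1:] \<in> polys_over A" using A01 by (simp add: polys_over_def coeff_pCons split: nat.split)
    then have y: "Var y \<in> ?A" by (intro image_eqI[of _ _ "[:0, 1:]"]) simp_all
    have sum: "(\<Sum>i\<in>I. g i) \<in> A" if "finite I" "\<And>i. i \<in> I \<Longrightarrow> g i \<in> A" for I :: "nat set" and g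
      using that by (induction I rule: finite_induct) (use A01 plus in auto)
    have "P - Q \<in> polys_over A \<and> P * Q \<in> polys_over A" if "P \<in> polys_over A" "Q \<in> polys_over A" for P Q
      using that A(3,4) by (auto simp: polys_over_def coeff_mult intro!: sum)
    then have ring: "\<forall>a\<in>?A. \<forall>b\<in>?A. a - b \<in> ?A \<and> a * b \<in> ?A"
      by (auto simp: poly_diff[symmetric] poly_mult[symmetric] simp del: poly_diff poly_mult)
    have "partial_deriv i (poly P (Var y)) = 0" if "P \<in> polys_over A" "i \<notin> insert y V" for P i
      using that by (subst derivation_poly_killing_coeffs[OF derivation_partial_deriv])
        (auto simp: partial_deriv_Var polys_over_def A(5))
    then have kill: "\<forall>i. \<forall>a\<in>?A. i \<notin> insert y V \<longrightarrow> partial_deriv i a = 0" by blast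
    have "Q (insert y V) ?A e' s'"
      unfolding Q_def using subset_trans[OF A(1) sub] subset_trans[OF A(2) sub] y ring kill e'p E''
      by (simp only: image_insert insert_subset simp_thms)
    then show ?case by blast
  qed
  from this[OF finite_UNIV] obtain A e s where "Q UNIV A e s" by blast
  then have A: "range Const \<subseteq> A" "range Var \<subseteq> A"
    "\<And>a b. a \<in> A \<Longrightarrow> b \<in> A \<Longrightarrow> a - b \<in> A" "\<And>a b. a \<in> A \<Longrightarrow> b \<in> A \<Longrightarrow> a * b \<in> A"
    and e: "\<forall>i. e i \<in> p" and E: "euler_derivation (?E e) s A"
    unfolding Q_def by simp_all
  have zero: "0 \<in> A" using A(1) Const_0 by (metis rangeI subsetD)
  have plus: "a + b \<in> A" if "a \<in> A" "b \<in> A" for a b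
    using A(3)[OF that(1) A(3)[OF zero that(2)]] by simp
  have "f \<in> A" for f
    by (induction f rule: mpoly_induct) (use A plus in auto)
  then have "A = UNIV" by blast
  with e E show ?thesis by blast
qed

text \<open>The hard inclusion of the Zariski--Nagata theorem for a prime ideal. By induction \<open>f\<close> and all
  \<open>\<partial>\<^sub>i f\<close> are in \<open>p\<^sup>(\<^sup>r\<^sup>)\<close>; the coefficients of the Euler derivation \<open>E\<close> are in \<open>p\<close>, so \<open>E f\<close> is in
  \<open>p\<^sup>(\<^sup>r\<^sup>+\<^sup>1\<^sup>)\<close>, and this forces \<open>f\<close> into \<open>p\<^sup>(\<^sup>r\<^sup>+\<^sup>1\<^sup>)\<close>.\<close>

theorem sym_power_if_partial_derivs_in_prime:
  assumes "\<And>\<alpha>. total_degree_exp \<alpha> < r \<Longrightarrow> partial_deriv_pow \<alpha> f \<in> p"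
  shows "f \<in> sym_power r"
proof -
  obtain e s where e: "\<And>i. e i \<in> p" and E: "euler_derivation (\<lambda>f. \<Sum>i\<in>UNIV. e i * partial_deriv i f) s UNIV"
    using euler_derivation_exists by blast
  show ?thesis using assms
  proof (induction r arbitrary: f)
    case 0
    show ?case by (rule sym_power_0)
  next
    case (Suc r)
    show ?case
    proof (cases "r = 0")
      case True
      then show ?thesis
        using Suc.prems[of 0] prime_subset_sym_power[of f] by (simp add: total_degree_exp_def One_nat_def)
    next
      case False
      have "f \<in> sym_power r" using Suc by simp
      moreover have "partial_deriv i f \<in> sym_power r" for i
      proof (rule Suc.IH)
        fix \<alpha> :: "'n \<Rightarrow>\<^sub>0 nat" assume "total_degree_exp \<alpha> < r"
        then show "partial_deriv_pow \<alpha> (partial_deriv i f) \<in> p"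
          using Suc.prems[of "\<alpha> + single i 1"]
          by (simp add: total_degree_exp_add total_degree_exp_single partial_deriv_pow_step)
      qed
      then have "(\<Sum>i\<in>UNIV. e i * partial_deriv i f) \<in> sym_power (r + 1)"
        unfolding mult.commute[of "e _"] by (intro sym_power_sum sym_power_mult_prime e)
      ultimately show ?thesis
        using sym_power_Suc_if_euler_derivation[OF E, of r f] False by (simp add: Suc_eq_plus1)
    qed
  qed
qed

end

section \<open>The polynomial ring is Noetherian\<close>

lemma nat_sequence_incseq_subsequence:
  fixes a :: "nat \<Rightarrow> nat"
  obtains g :: "nat \<Rightarrow> nat" where "strict_mono g" "incseq (\<lambda>n. a (g n))"
proof -
  obtain g :: "nat \<Rightarrow> nat" where g: "strict_mono g" "monoseq (\<lambda>n. a (g n))"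
    using seq_monosub by blast
  show thesis
  proof (cases "incseq (\<lambda>n. a (g n))")
    case True
    with g that show thesis by blast
  next
    case False
    with g(2) have dec: "decseq (\<lambda>n. a (g n))" by (auto simp: monoseq_iff)
    obtain N where N: "\<And>n. a (g N) \<le> a (g n)"
      using arg_min_nat_le[of "\<lambda>_. True" _ "\<lambda>n. a (g n)"] by blast
    have const: "a (g (N + n)) = a (g N)" for n
      using decseqD[OF dec, of N "N + n"] N[of "N + n"] by simp
    show thesis
    proof (rule that[of "\<lambda>n. g (N + n)"])
      show "strict_mono (\<lambda>n. g (N + n))" using g(1) by (simp add: strict_mono_def)
      show "incseq (\<lambda>n. a (g (N + n)))" unfolding const by (simp add: incseq_def)
    qed
  qed
qed

text \<open>Dickson's lemma, by passing to a subsequence for each of the finitely many coordinates.\<close>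

lemma dickson:
  fixes a :: "nat \<Rightarrow> 'n::finite \<Rightarrow>\<^sub>0 nat"
  shows "\<exists>i j. i < j \<and> (\<forall>k. lookup (a i) k \<le> lookup (a j) k)"
proof -
  have "\<exists>g :: nat \<Rightarrow> nat. strict_mono g \<and> (\<forall>k\<in>V. incseq (\<lambda>n. lookup (a (g n)) k))" if "finite V" for V
    using that
  proof (induction V rule: finite_induct)
    case empty
    show ?case by (intro exI[of _ id]) (simp add: strict_mono_def)
  next
    case (insert y V)
    then obtain g :: "nat \<Rightarrow> nat" where g: "strict_mono g" "\<forall>k\<in>V. incseq (\<lambda>n. lookup (a (g n)) k)" by blast
    obtain g' :: "nat \<Rightarrow> nat" where g': "strict_mono g'" "incseq (\<lambda>n. lookup (a (g (g' n))) y)"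
      by (rule nat_sequence_incseq_subsequence[of "\<lambda>n. lookup (a (g n)) y"])
    have "incseq (\<lambda>n. lookup (a (g (g' n))) k)" if "k \<in> V" for k
      using g(2) that g'(1) by (auto simp: incseq_def strict_mono_less_eq)
    moreover have "strict_mono (\<lambda>n. g (g' n))"
      using g(1) g'(1) by (simp add: strict_mono_def)
    ultimately show ?case
      using g'(2) by (intro exI[of _ "\<lambda>n. g (g' n)"]) auto
  qed
  from this[OF finite_UNIV] obtain g :: "nat \<Rightarrow> nat"
    where g: "strict_mono g" "\<And>k. incseq (\<lambda>n. lookup (a (g n)) k)" by blast
  have "g 0 < g 1" using g(1) by (simp add: strict_mono_def)
  moreover have "lookup (a (g 0)) k \<le> lookup (a (g 1)) k" for k
    using incseqD[OF g(2), of 0 1] by simp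
  ultimately show ?thesis by blast
qed

text \<open>The linear order on exponent vectors is the lexicographic one. It is compatible with the
  componentwise order, so Dickson's lemma excludes infinite descents.\<close>

lemma wf_exponents: "wf {(\<alpha>, \<beta> :: 'n::{finite,linorder} \<Rightarrow>\<^sub>0 nat). \<alpha> < \<beta>}"
  unfolding wf_iff_no_infinite_down_chain
proof
  assume "\<exists>a. \<forall>i. (a (Suc i), a i) \<in> {(\<alpha>, \<beta> :: 'n \<Rightarrow>\<^sub>0 nat). \<alpha> < \<beta>}"
  then obtain a :: "nat \<Rightarrow> 'n \<Rightarrow>\<^sub>0 nat" where a: "\<And>i. a (Suc i) < a i" by auto
  obtain i j where "i < j" and le: "\<And>k. lookup (a i) k \<le> lookup (a j) k"
    using dickson[of a] by blast
  have "a (Suc n + i) < a i" for n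
    by (induction n) (use a in \<open>auto intro: less_trans\<close>)
  from this[of "j - Suc i"] have "a j < a i" using \<open>i < j\<close> by simp
  then have "less_fun (lookup (a j)) (lookup (a i))" by (simp add: less_poly_mapping.rep_eq)
  then obtain k where "lookup (a j) k < lookup (a i) k" by (auto simp: less_fun_def)
  with le[of k] show False by simp
qed

definition lead_exponent :: "('n::linorder, 'k::zero) mpoly \<Rightarrow> ('n \<Rightarrow>\<^sub>0 nat)" where
  "lead_exponent f = Max (keys f)"

lemma lead_exponent_in_keys: "f \<noteq> 0 \<Longrightarrow> lead_exponent f \<in> keys f"
  unfolding lead_exponent_def by (intro Max_in) auto

lemma le_lead_exponent: "m \<in> keys f \<Longrightarrow> m \<le> lead_exponent f"
  unfolding lead_exponent_def by (intro Max_ge) auto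

lemma lookup_single_mult:
  fixes f :: "('n, 'k::comm_ring_1) mpoly"
  shows "lookup (single \<delta> c * f) (\<delta> + m) = c * lookup f m"
  by (induction f rule: poly_mapping_add_induct)
     (auto simp: mult_single lookup_single when_def distrib_left lookup_add)

lemma lead_exponent_cancel:
  fixes f g :: "('n::linorder, 'k::field) mpoly"
  assumes "f \<noteq> 0" "g \<noteq> 0" and le: "\<And>i. lookup (lead_exponent f) i \<le> lookup (lead_exponent g) i"
  obtains h where "g - h * f = 0 \<or> lead_exponent (g - h * f) < lead_exponent g"
proof -
  define \<delta> where "\<delta> = lead_exponent g - lead_exponent f"
  define c where "c = lookup g (lead_exponent g) / lookup f (lead_exponent f)"
  have \<delta>: "\<delta> + lead_exponent f = lead_exponent g"
    using le by (intro poly_mapping_eqI) (simp add: \<delta>_def lookup_add lookup_minus)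
  let ?r = "g - single \<delta> c * f"
  have "lookup f (lead_exponent f) \<noteq> 0"
    using lead_exponent_in_keys[OF assms(1)] by (simp add: in_keys_iff)
  then have "lookup ?r (lead_exponent g) = 0"
    using lookup_single_mult[of \<delta> c f "lead_exponent f"] by (simp add: lookup_minus \<delta> c_def)
  then have notin: "lead_exponent g \<notin> keys ?r" by (simp add: in_keys_iff)
  have bound: "m \<le> lead_exponent g" if "m \<in> keys ?r" for m
  proof -
    from that consider "m \<in> keys g" | "m \<in> keys (single \<delta> c * f)" by (fastforce simp: in_keys_iff lookup_minus)
    then show ?thesis
    proof cases
      case 2
      then obtain k where "m = \<delta> + k" "k \<in> keys f"
        using keys_mult[of "single \<delta> c" f] by (auto split: if_splits)
      then show ?thesis using le_lead_exponent[of k f] add_left_mono[of k "lead_exponent f" \<delta>] \<delta> by simp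
    qed (rule le_lead_exponent)
  qed
  have "?r = 0 \<or> lead_exponent ?r < lead_exponent g"
    using lead_exponent_in_keys[of ?r] bound notin by (metis order_le_less)
  then show thesis by (rule that)
qed

text \<open>Hilbert's basis theorem. In an ideal that is not finitely generated, one can choose again and again an
  element of least leading exponent outside the ideal generated by the previous choices. By Dickson's lemma some
  leading exponent divides a later one, and cancelling the leading term contradicts the minimality of the
  later choice.\<close>

theorem ideal_finitely_generated:
  fixes I :: "('n::{finite,linorder}, 'k::field) mpoly set"
  assumes I: "is_ideal I"
  shows "\<exists>S. finite S \<and> I = mod_self.span S"
proof (rule ccontr)
  assume not_fg: "\<nexists>S. finite S \<and> I = mod_self.span S"
  have "\<exists>f. f \<in> I - mod_self.span S \<and>
      (\<forall>g\<in>I - mod_self.span S. \<not> lead_exponent g < lead_exponent f)"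
    if S: "finite S" "S \<subseteq> I" for S
  proof -
    have "mod_self.span S \<subseteq> I" using S(2) I by (simp add: mod_self.span_minimal is_ideal_iff)
    with not_fg S(1) have "I - mod_self.span S \<noteq> {}" by blast
    then obtain x where "x \<in> lead_exponent ` (I - mod_self.span S)" by blast
    then obtain z where "z \<in> lead_exponent ` (I - mod_self.span S)"
      "\<And>y. y < z \<Longrightarrow> y \<notin> lead_exponent ` (I - mod_self.span S)"
      using wf_exponents unfolding wf_eq_minimal by (metis (no_types, lifting) case_prodI mem_Collect_eq)
    then show ?thesis by blast
  qed
  then obtain c where c: "\<And>S. finite S \<Longrightarrow> S \<subseteq> I \<Longrightarrow> c S \<in> I - mod_self.span S"
    and c_min: "\<And>S g. finite S \<Longrightarrow> S \<subseteq> I \<Longrightarrow> g \<in> I - mod_self.span S \<Longrightarrow>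
        \<not> lead_exponent g < lead_exponent (c S)"
    by metis
  define B where "B = rec_nat {} (\<lambda>_ S. insert (c S) S)"
  have B_0: "B 0 = {}" and B_Suc: "\<And>n. B (Suc n) = insert (c (B n)) (B n)"
    by (simp_all add: B_def)
  have B: "finite (B n) \<and> B n \<subseteq> I" for n
    by (induction n) (use c in \<open>auto simp: B_0 B_Suc\<close>)
  have B_mem: "c (B i) \<in> B j" if "i < j" for i j
    using that by (induction j) (auto simp: B_Suc less_Suc_eq)
  have nz: "c (B n) \<noteq> 0" for n
    using c[of "B n"] B[of n] mod_self.span_zero[of "B n"] by auto
  obtain i j where ij: "i < j"
    "\<And>k. lookup (lead_exponent (c (B i))) k \<le> lookup (lead_exponent (c (B j))) k"
    using dickson[of "\<lambda>n. lead_exponent (c (B n))"] by blast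
  obtain h where h: "c (B j) - h * c (B i) = 0 \<or>
      lead_exponent (c (B j) - h * c (B i)) < lead_exponent (c (B j))"
    by (rule lead_exponent_cancel[OF nz nz ij(2)])
  have in_span: "h * c (B i) \<in> mod_self.span (B j)"
    by (intro mod_self.span_scale mod_self.span_base B_mem ij)
  have cj: "c (B j) \<in> I - mod_self.span (B j)" using c B by blast
  then have "c (B j) - h * c (B i) \<notin> mod_self.span (B j)"
    using mod_self.span_add[OF _ in_span, of "c (B j) - h * c (B i)"] by auto
  moreover from this have "c (B j) - h * c (B i) \<noteq> 0" using mod_self.span_zero by metis
  moreover have "c (B j) - h * c (B i) \<in> I"
    using cj c B by (intro ideal_diff[OF I] ideal_mult[OF I]) blast+
  ultimately show False using c_min[of "B j"] B h by blast
qed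

lemma noetherian_mpoly: "noetherian_ring (type_ring :: ('n::{finite,linorder}, 'k::field) mpoly ring)"
  by (rule ring.noetherian_ringI[OF ring_from_type_algebra])
     (use ideal_finitely_generated in \<open>auto simp: genideal_eq_span\<close>)

section \<open>Associated primes and localization\<close>

lemma primeideal_type_ring_iff:
  "primeideal p (type_ring :: 'a::comm_ring_1 ring) \<longleftrightarrow>
     is_ideal p \<and> 1 \<notin> p \<and> (\<forall>a b. a * b \<in> p \<longrightarrow> a \<in> p \<or> b \<in> p)"
proof
  assume "primeideal p (type_ring :: 'a ring)"
  then interpret p: primeideal p "type_ring :: 'a ring" .
  have "1 \<notin> p" using p.I_notcarr ideal_mult_right[OF p.is_ideal, of 1] by auto
  then show "is_ideal p \<and> 1 \<notin> p \<and> (\<forall>a b. a * b \<in> p \<longrightarrow> a \<in> p \<or> b \<in> p)"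
    using p.is_ideal p.I_prime by auto
next
  assume "is_ideal p \<and> 1 \<notin> p \<and> (\<forall>a b. a * b \<in> p \<longrightarrow> a \<in> p \<or> b \<in> p)"
  then show "primeideal p (type_ring :: 'a ring)"
    by (intro primeidealI[OF _ cring_from_type_algebra]) auto
qed

lemma annihilator_Quot_coset:
  fixes J :: "'a::comm_ring_1 set"
  assumes "is_ideal J"
  shows "annihilator_Quot J (J +>\<^bsub>type_ring\<^esub> a) = {b. b * a \<in> J}"
proof -
  interpret J: ideal J "type_ring :: 'a ring" by (rule assms)
  have "J +>\<^bsub>type_ring\<^esub> x = J \<longleftrightarrow> x \<in> J" for x
    using J.a_rcos_self[of x] J.a_rcos_const[of x] by auto
  then show ?thesis
    by (simp add: annihilator_Quot_def FactRing_def J.rcoset_mult_add)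
qed

lemma Ass_iff:
  fixes J :: "'a::comm_ring_1 set"
  assumes "is_ideal J"
  shows "p \<in> Ass J \<longleftrightarrow> primeideal p type_ring \<and> (\<exists>a. p = {b. b * a \<in> J})"
proof -
  have "carrier (type_ring Quot J) = Set.range (\<lambda>a. J +>\<^bsub>type_ring\<^esub> a)"
    by (auto simp: FactRing_def A_RCOSETS_def')
  then show ?thesis by (auto simp: Ass_def annihilator_Quot_coset[OF assms])
qed

text \<open>Among the colon ideals \<open>(J : g h)\<close> with \<open>g h \<notin> J\<close> there is a maximal one, since the ring is
  Noetherian, and maximality makes it prime. It cannot contain \<open>g\<close>, for otherwise \<open>(g h)\<^sup>2 \<in> J\<close> although \<open>J\<close> is
  radical. Consequently a radical ideal is the intersection of its associated primes.\<close>

lemma exists_associated_prime_avoiding: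
  fixes J :: "('n::{finite,linorder}, 'k::field) mpoly set"
  assumes J: "is_ideal J" and rad: "ideal_radical J = J" and g: "g \<notin> J"
  obtains p where "p \<in> Ass J" "g \<notin> p"
proof -
  define colon where "colon a = {b. b * a \<in> J}" for a
  define \<A> where "\<A> = {colon (g * h) | h. g * h \<notin> J}"
  have ideal_colon: "is_ideal (colon a)" for a
    unfolding is_ideal_iff colon_def
    using ideal_0[OF J] ideal_add[OF J] ideal_mult[OF J]
    by (intro mod_self.subspaceI) (auto simp: distrib_right mult.assoc)
  have "colon (g * 1) \<in> \<A>" using g unfolding \<A>_def by (metis (mono_tags, lifting) mem_Collect_eq mult_1_right)
  then have "\<A> \<noteq> {}" by blast
  moreover have "\<Union>C \<in> \<A>" if C: "C \<noteq> {}" "subset.chain \<A> C" for C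
  proof -
    have "\<A> \<subseteq> {I. is_ideal I}" using ideal_colon by (auto simp: \<A>_def)
    then have "subset.chain {I. is_ideal I} C" using C(2) unfolding subset.chain_def by blast
    from noetherian_ring.ideal_chain_is_trivial[OF noetherian_mpoly C(1) this]
    show ?thesis using C(2) unfolding subset.chain_def by blast
  qed
  ultimately obtain p where p: "p \<in> \<A>" and p_max: "\<And>q. q \<in> \<A> \<Longrightarrow> p \<subseteq> q \<Longrightarrow> q = p"
    using subset_Zorn_nonempty[of \<A>] by blast
  obtain h where h: "p = colon (g * h)" "g * h \<notin> J" using p by (auto simp: \<A>_def)
  have "1 \<notin> p" using h by (simp add: colon_def)
  moreover have "b \<in> p" if "a * b \<in> p" "a \<notin> p" for a b
  proof -
    have "g * (h * a) \<notin> J" using that(2) h by (simp add: colon_def mult_ac)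
    then have "colon (g * (h * a)) \<in> \<A>" by (auto simp: \<A>_def)
    moreover have "p \<subseteq> colon (g * (h * a))"
    proof
      fix x assume "x \<in> p"
      then have "a * (x * (g * h)) \<in> J" using ideal_mult[OF J] by (simp add: h colon_def)
      then show "x \<in> colon (g * (h * a))" by (simp add: colon_def mult_ac)
    qed
    ultimately have "colon (g * (h * a)) = p" by (rule p_max)
    moreover have "b \<in> colon (g * (h * a))" using that(1) h by (simp add: colon_def mult_ac)
    ultimately show ?thesis by simp
  qed
  ultimately have "primeideal p type_ring"
    unfolding primeideal_type_ring_iff using ideal_colon h(1) by blast
  then have "p \<in> Ass J" unfolding Ass_iff[OF J] using h(1) by (auto simp: colon_def)
  moreover have "g \<notin> p"
  proof
    assume "g \<in> p"
    then have "h * (g * (g * h)) \<in> J" using ideal_mult[OF J] by (simp add: h colon_def)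
    then have "(g * h) ^ 2 \<in> J" by (simp add: power2_eq_square mult_ac)
    then have "g * h \<in> ideal_radical J" unfolding ideal_radical_def by blast
    with rad h show False by simp
  qed
  ultimately show thesis by (rule that)
qed

lemma subring_localization:
  fixes p :: "'a::idom set"
  assumes p: "is_ideal p" "1 \<notin> p" "\<And>a b. a * b \<in> p \<Longrightarrow> a \<in> p \<or> b \<in> p"
  shows "subring {Fraction_Field.Fract a s | a s. s \<notin> p} (type_ring :: 'a fract ring)"
    (is "subring ?H _")
proof -
  have nz: "s \<noteq> 0" if "s \<notin> p" for s using that ideal_0[OF p(1)] by auto
  interpret R: ring "type_ring :: 'a fract ring" by (rule ring_from_type_algebra)
  have minus: "\<ominus>\<^bsub>type_ring\<^esub> x = - x" for x :: "'a fract"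
    by (rule R.minus_equality) auto
  show ?thesis
  proof (rule R.subringI)
    show "\<one>\<^bsub>type_ring\<^esub> \<in> ?H" using p(2) by (auto simp: One_fract_def)
    show "\<ominus>\<^bsub>type_ring\<^esub> h \<in> ?H" if "h \<in> ?H" for h
      using that by (auto simp: minus; blast)
    show "h \<otimes>\<^bsub>type_ring\<^esub> h' \<in> ?H" if hh: "h \<in> ?H" "h' \<in> ?H" for h h'
    proof -
      obtain a s b t where "h = Fraction_Field.Fract a s" "s \<notin> p" "h' = Fraction_Field.Fract b t" "t \<notin> p"
        using hh by blast
      then show ?thesis using p(3)[of s t] by auto
    qed
    show "h \<oplus>\<^bsub>type_ring\<^esub> h' \<in> ?H" if hh: "h \<in> ?H" "h' \<in> ?H" for h h'
    proof -
      obtain a s b t where "h = Fraction_Field.Fract a s" "s \<notin> p" "h' = Fraction_Field.Fract b t" "t \<notin> p"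
        using hh by blast
      then show ?thesis using p(3)[of s t] nz by auto
    qed
  qed simp
qed

text \<open>The extension of \<open>I\<close> to the localization consists of the fractions with numerator in \<open>I\<close>: these form
  an ideal of the localization, and \<open>1/s\<close> is available to produce them.\<close>

lemma extended_ideal_contraction:
  fixes p I :: "'a::idom set"
  assumes p: "is_ideal p" "1 \<notin> p" "\<And>a b. a * b \<in> p \<Longrightarrow> a \<in> p \<or> b \<in> p" and I: "is_ideal I"
  shows "Fraction_Field.Fract f 1 \<in> extended_ideal p I \<longleftrightarrow> (\<exists>s. s \<notin> p \<and> s * f \<in> I)"
proof
  let ?L = "localization p" and ?\<iota> = "\<lambda>a. Fraction_Field.Fract a 1"
  have nz: "s \<noteq> 0" if "s \<notin> p" for s using that ideal_0[OF p(1)] by auto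
  have carrier: "carrier ?L = {Fraction_Field.Fract a s | a s. s \<notin> p}"
    and sel: "monoid.mult ?L = (*)" "add ?L = (+)" "ring.zero ?L = 0" "one ?L = 1"
    by (simp_all add: localization_def)
  assume "Fraction_Field.Fract f 1 \<in> extended_ideal p I"
  interpret L: ring ?L
    unfolding localization_def
    by (rule ring.subring_is_ring[OF ring_from_type_algebra subring_localization[OF p]])
  define E where "E = {Fraction_Field.Fract a s | a s. a \<in> I \<and> s \<notin> p}"
  have E: "ideal E ?L"
  proof (rule idealI[OF L.ring_axioms])
    show "subgroup E (add_monoid ?L)"
    proof (rule L.add.subgroupI)
      show "E \<subseteq> carrier ?L" by (auto simp: E_def carrier)
      show "E \<noteq> {}" using ideal_0[OF I] p(2) by (auto simp: E_def)
      show "\<ominus>\<^bsub>?L\<^esub> x \<in> E" if "x \<in> E" for x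
      proof -
        obtain a s where x: "x = Fraction_Field.Fract a s" "a \<in> I" "s \<notin> p"
          using \<open>x \<in> E\<close> unfolding E_def by blast
        have "- a \<in> I" using ideal_mult[OF I x(2), of "-1"] by simp
        moreover have "\<ominus>\<^bsub>?L\<^esub> x = Fraction_Field.Fract (- a) s"
        proof (rule L.minus_equality)
          show "Fraction_Field.Fract (- a) s \<oplus>\<^bsub>?L\<^esub> x = \<zero>\<^bsub>?L\<^esub>"
            unfolding sel x(1) minus_fract[symmetric] by (rule left_minus)
        qed (use x in \<open>auto simp: carrier\<close>)
        ultimately show ?thesis using x(3) by (auto simp: E_def)
      qed
      show "x \<oplus>\<^bsub>?L\<^esub> y \<in> E" if xy: "x \<in> E" "y \<in> E" for x y
      proof -
        obtain a s b t where x: "x = Fraction_Field.Fract a s" "a \<in> I" "s \<notin> p"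
          and y: "y = Fraction_Field.Fract b t" "b \<in> I" "t \<notin> p"
          using xy unfolding E_def by blast
        have "a * t + b * s \<in> I" using x y by (intro ideal_add[OF I] ideal_mult_right[OF I])
        moreover have "s * t \<notin> p" using x y p(3) by blast
        ultimately show ?thesis using nz x y by (auto simp: E_def sel)
      qed
    qed
    have mult: "x * y \<in> E" if xy: "x \<in> E" "y \<in> carrier ?L" for x y
    proof -
      obtain a s b t where x: "x = Fraction_Field.Fract a s" "a \<in> I" "s \<notin> p"
        and y: "y = Fraction_Field.Fract b t" "t \<notin> p"
        using xy unfolding E_def carrier by blast
      have "a * b \<in> I" using x by (intro ideal_mult_right[OF I])
      moreover have "s * t \<notin> p" using x y p(3) by blast
      ultimately show ?thesis using x y by (auto simp: E_def)
    qed
    then show "x \<otimes>\<^bsub>?L\<^esub> a \<in> E" "a \<otimes>\<^bsub>?L\<^esub> x \<in> E" if "a \<in> E" "x \<in> carrier ?L" for a x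
      using that by (simp_all add: sel mult.commute[of x])
  qed
  have "?\<iota> ` I \<subseteq> E" using p(2) by (auto simp: E_def)
  with E have "extended_ideal p I \<subseteq> E" unfolding extended_ideal_def by (rule L.genideal_minimal)
  with \<open>Fraction_Field.Fract f 1 \<in> extended_ideal p I\<close>
  obtain a s where "Fraction_Field.Fract f 1 = Fraction_Field.Fract a s" "a \<in> I" "s \<notin> p"
    by (auto simp: E_def)
  then show "\<exists>s. s \<notin> p \<and> s * f \<in> I" using nz by (auto simp: eq_fract mult.commute)
next
  let ?L = "localization p" and ?\<iota> = "\<lambda>a. Fraction_Field.Fract a 1"
  assume "\<exists>s. s \<notin> p \<and> s * f \<in> I"
  then obtain s where s: "s \<notin> p" "s * f \<in> I" by blast
  then have "s \<noteq> 0" using ideal_0[OF p(1)] by auto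
  show "Fraction_Field.Fract f 1 \<in> extended_ideal p I"
    unfolding extended_ideal_def genideal_def
  proof (intro InterI, elim CollectE conjE)
    fix I' assume I': "ideal I' ?L" "?\<iota> ` I \<subseteq> I'"
    have "Fraction_Field.Fract 1 s \<in> carrier ?L" using s by (auto simp: localization_def)
    moreover have "?\<iota> (s * f) \<in> I'" using I'(2) s by blast
    ultimately have "Fraction_Field.Fract 1 s \<otimes>\<^bsub>?L\<^esub> ?\<iota> (s * f) \<in> I'"
      by (intro ideal.I_l_closed[OF I'(1)])
    also have "Fraction_Field.Fract 1 s \<otimes>\<^bsub>?L\<^esub> ?\<iota> (s * f) = Fraction_Field.Fract (s * f) (s * 1)"
      by (simp add: localization_def)
    finally have "Fraction_Field.Fract (s * f) (s * 1) \<in> I'" .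
    moreover have "Fraction_Field.Fract (s * f) (s * 1) = Fraction_Field.Fract f 1"
      using \<open>s \<noteq> 0\<close> by (simp add: eq_fract)
    ultimately show "Fraction_Field.Fract f 1 \<in> I'" by (simp only:)
  qed
qed

lemma symbolic_power_eq:
  fixes J :: "('n::{finite,linorder}, 'k::field_char_0) mpoly set"
  assumes J: "is_ideal J"
  shows "symbolic_power J r = {f. \<forall>p\<in>Ass J. \<exists>s. s \<notin> p \<and> s * f \<in> ideal_power J r}"
proof -
  have "Fraction_Field.Fract f 1 \<in> extended_ideal p (ideal_power J r) \<longleftrightarrow>
      (\<exists>s. s \<notin> p \<and> s * f \<in> ideal_power J r)" if "p \<in> Ass J" for p f
    using that by (intro extended_ideal_contraction is_ideal_power J)
      (auto simp: Ass_iff[OF J] primeideal_type_ring_iff)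
  then show ?thesis by (auto simp: symbolic_power_def)
qed

lemma ideal_power_Suc_subset:
  assumes "is_ideal I"
  shows "ideal_power I (Suc r) \<subseteq> ideal_power I r \<inter> I"
proof
  fix f assume "f \<in> ideal_power I (Suc r)"
  then show "f \<in> ideal_power I r \<inter> I"
    using ideal_mult[OF assms] ideal_mult_right[OF is_ideal_power[OF assms]]
      ideal_add[OF assms] ideal_add[OF is_ideal_power[OF assms]]
    by (induction rule: ideal_power_Suc_induct) auto
qed

lemma partial_deriv_ideal_power:
  assumes I: "is_ideal I" and "f \<in> ideal_power I (Suc r)"
  shows "partial_deriv i f \<in> ideal_power I r"
  using assms(2)
proof (induction r arbitrary: f)
  case 0
  then show ?case by (simp add: ideal_power_0)
next
  case (Suc r)
  note P = is_ideal_power[OF I]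
  from Suc.prems show ?case
  proof (induction rule: ideal_power_Suc_induct)
    case (prod g h)
    then show ?case
      unfolding partial_deriv_mult
      by (intro ideal_add[OF P] ideal_mult_right[OF P] ideal_power_mult_Suc Suc.IH)
  qed (simp add: partial_deriv_add ideal_add[OF P])
qed

text \<open>Each derivative costs one power of \<open>I\<close>. The multiplier \<open>s\<close> is differentiated as well, which is
  compensated by multiplying once more with \<open>s\<close>: \<open>s\<^sup>2 \<partial>f = s \<partial>(s f) - \<partial>s (s f)\<close>.\<close>

lemma partial_deriv_pow_locally_in_ideal_power:
  assumes I: "is_ideal I" and prime: "\<And>a b. a * b \<in> p \<Longrightarrow> a \<in> p \<or> b \<in> p"
    and "\<exists>s. s \<notin> p \<and> s * f \<in> ideal_power I (total_degree_exp \<alpha> + k)"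
  shows "\<exists>s. s \<notin> p \<and> s * partial_deriv_pow \<alpha> f \<in> ideal_power I k"
  using assms(3)
proof (induction \<alpha> arbitrary: f rule: exponent_induct)
  case zero
  then show ?case by (simp add: total_degree_exp_def)
next
  case (add_var m i)
  let ?r = "total_degree_exp m + k"
  note P = is_ideal_power[OF I, of ?r]
  obtain s where s: "s \<notin> p" "s * f \<in> ideal_power I (Suc ?r)"
  proof -
    have "total_degree_exp (m + single i 1) + k = Suc ?r"
      by (simp add: total_degree_exp_add total_degree_exp_single)
    then show thesis using add_var.prems that by auto
  qed
  have "s * (s * partial_deriv i f + partial_deriv i s * f) - partial_deriv i s * (s * f) \<in> ideal_power I ?r"
  proof (rule ideal_diff[OF P ideal_mult[OF P] ideal_mult[OF P]])
    show "s * partial_deriv i f + partial_deriv i s * f \<in> ideal_power I ?r"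
      using partial_deriv_ideal_power[OF I s(2), of i] by (simp add: partial_deriv_mult)
    show "s * f \<in> ideal_power I ?r"
      using ideal_power_Suc_subset[OF I, of ?r] s(2) by blast
  qed
  then have "s * s * partial_deriv i f \<in> ideal_power I ?r" by (simp add: algebra_simps)
  moreover have "s * s \<notin> p" using s(1) prime by blast
  ultimately show ?case unfolding partial_deriv_pow_step by (intro add_var.IH) blast
qed

text \<open>The theorem of Zariski and Nagata for radical ideals. The reduction of the second inclusion to primes uses
  that for \<open>p = (J : a)\<close> the multiplier \<open>a\<close> is outside \<open>p\<close> and satisfies \<open>a p \<subseteq> J\<close>, so that
  \<open>a\<^sup>r p\<^sup>r \<subseteq> J\<^sup>r\<close>.\<close>

theorem symbolic_power_eq_partial_derivs:
  fixes J :: "('n::{finite,linorder}, 'k::field_char_0) mpoly set"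
  assumes J: "is_ideal J" and rad: "ideal_radical J = J"
  shows "symbolic_power J r = {f. \<forall>\<alpha>. total_degree_exp \<alpha> < r \<longrightarrow> partial_deriv_pow \<alpha> f \<in> J}"
    (is "_ = ?D")
proof
  show "symbolic_power J r \<subseteq> ?D"
  proof (intro subsetI CollectI allI impI, rule ccontr)
    fix f \<alpha> assume f: "f \<in> symbolic_power J r" and \<alpha>: "total_degree_exp \<alpha> < r"
      and "partial_deriv_pow \<alpha> f \<notin> J"
    then obtain p where p: "p \<in> Ass J" and notin: "partial_deriv_pow \<alpha> f \<notin> p"
      using exists_associated_prime_avoiding[OF J rad] by blast
    from p obtain a where "p = {b. b * a \<in> J}"
      and prime: "is_ideal p" "\<And>a b. a * b \<in> p \<Longrightarrow> a \<in> p \<or> b \<in> p"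
      unfolding Ass_iff[OF J] primeideal_type_ring_iff by blast
    then have "J \<subseteq> p" using ideal_mult_right[OF J] by blast
    obtain k where k: "r = total_degree_exp \<alpha> + Suc k" using \<alpha> less_natE by (metis add_Suc_right)
    obtain s where "s \<notin> p" "s * partial_deriv_pow \<alpha> f \<in> ideal_power J (Suc k)"
      using partial_deriv_pow_locally_in_ideal_power[OF J prime(2), of f \<alpha> "Suc k"] f p
      unfolding symbolic_power_eq[OF J] k by blast
    then have "s * partial_deriv_pow \<alpha> f \<in> p"
      using ideal_power_Suc_subset[OF J] \<open>J \<subseteq> p\<close> by blast
    with prime(2) \<open>s \<notin> p\<close> notin show False by blast
  qed
next
  show "?D \<subseteq> symbolic_power J r"
    unfolding symbolic_power_eq[OF J]
  proof (intro subsetI CollectI ballI)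
    fix f p assume f: "f \<in> ?D" and "p \<in> Ass J"
    then obtain a where p: "p = {b. b * a \<in> J}"
      and pr: "is_ideal p" "1 \<notin> p" "\<And>a b. a * b \<in> p \<Longrightarrow> a \<in> p \<or> b \<in> p"
      unfolding Ass_iff[OF J] primeideal_type_ring_iff by blast
    interpret mpoly_prime p by (rule mpoly_prime.intro[OF pr])
    have "J \<subseteq> p" using ideal_mult_right[OF J] by (auto simp: p)
    with f have "f \<in> sym_power r" by (intro sym_power_if_partial_derivs_in_prime) blast
    then obtain s where s: "s \<notin> p" "s * f \<in> ideal_power p r" unfolding sym_power_def by blast
    have a: "a \<notin> p"
    proof
      assume "a \<in> p"
      then have "a ^ 2 \<in> J" by (simp add: p power2_eq_square)
      then have "a \<in> J" using rad unfolding ideal_radical_def by blast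
      then show False using pr(2) by (simp add: p)
    qed
    then have "a ^ r \<notin> p" by (induction r) (use pr in auto)
    then have "a ^ r * s \<notin> p" using s(1) pr(3) by blast
    moreover have "a ^ r * g \<in> ideal_power J r" if "g \<in> ideal_power p r" for g
      using that
    proof (induction r arbitrary: g)
      case (Suc r)
      from Suc.prems show ?case
      proof (induction rule: ideal_power_Suc_induct)
        case (prod g h)
        then have "(a ^ r * g) * (h * a) \<in> ideal_power J (Suc r)"
          by (intro ideal_power_mult_Suc Suc.IH) (simp_all add: p)
        then show ?case by (simp add: mult_ac)
      qed (simp add: distrib_left ideal_add[OF is_ideal_power[OF J]])
    qed (simp add: ideal_power_0)
    from this[OF s(2)] have "a ^ r * s * f \<in> ideal_power J r" by (simp add: mult.assoc)
    ultimately show "\<exists>s. s \<notin> p \<and> s * f \<in> ideal_power J r" by blast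
  qed
qed

theorem theorem7p1:
  fixes J M :: "('n::{finite,linorder}, 'k::field_char_0) mpoly set"
  assumes "is_ideal J"
    and "is_primary_to M max_ideal_0"
  shows "J \<star> M = {f. \<forall>A\<in>\<AA> M. A f \<in> J} \<and>
    (\<forall>r::nat. ideal_radical J = J \<longrightarrow>
      symbolic_power J r = J \<star> ideal_power max_ideal_0 r \<and>
      J \<star> ideal_power max_ideal_0 r =
        {f. \<forall>\<alpha>. int (total_degree_exp \<alpha>) \<le> int r - 1 \<longrightarrow> partial_deriv_pow \<alpha> f \<in> J})"
proof (intro conjI allI impI)
  show "J \<star> M = {f. \<forall>A\<in>\<AA> M. A f \<in> J}"
    using assms(2) by (intro ideal_join_eq assms(1) finite_monomials_outside_primary)
      (simp_all add: is_primary_to_def primary_ideal_def)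
next
  fix r :: nat assume rad: "ideal_radical J = J"
  show "symbolic_power J r = J \<star> ideal_power max_ideal_0 r"
    by (simp only: symbolic_power_eq_partial_derivs[OF assms(1) rad] ideal_join_max_ideal_power[OF assms(1)])
  have "int (total_degree_exp \<alpha>) \<le> int r - 1 \<longleftrightarrow> total_degree_exp \<alpha> < r" for \<alpha> :: "'n \<Rightarrow>\<^sub>0 nat"
    by linarith
  then show "J \<star> ideal_power max_ideal_0 r =
      {f. \<forall>\<alpha>. int (total_degree_exp \<alpha>) \<le> int r - 1 \<longrightarrow> partial_deriv_pow \<alpha> f \<in> J}"
    by (simp only: ideal_join_max_ideal_power[OF assms(1)])
qed

end
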